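(* Let $k\in\mathbb{Z}$ and let $c>1$, $p,q,r\ge0$ with $p+q+r=1$, $p+r>0$, $q+r>0$ be fixed. If $\mu^{(k)}$ is infinitely divisible, then $\mu^{(k+1)}$ is infinitely divisible.
   Context: For $k\in\mathbb{Z}$ let $\{(N_t^{(k)},L_t^{(k)}),t\ge0\}$ be the bivariate compound Poisson process (pure jump, no drift) with $E[e^{i(z_1N_t^{(k)}+z_2L_t^{(k)})}]=\exp[t\int_{\mathbb{R}^2}(e^{i(z_1x_1+z_2x_2)}-1)\nu^{(k)}(dx)]$, where $\nu^{(k)}$ is concentrated on the points $(1,0)$, $(0,1)$, $(1,c^{-k})$ with masses $u,v,w\ge0$ respectively, and $p=u/(u+v+w)$, $q=v/(u+v+w)$, $r=w/(u+v+w)$. Define $\mu^{(k)}$ as the distribution of $\int_0^{\infty-}c^{-N^{(k)}_{s-}}\,dL_s^{(k)}$ (the almost sure limit of $\int_0^t$ as $t\to\infty$, which exists). It depends on $u,v,w$ only through $p,q,r$. *)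

theory Defs
  imports "HOL-Probability.Probability"
begin

definition cadlag :: "(real \<Rightarrow> 'b::topological_space) \<Rightarrow> bool" where
  "cadlag f \<longleftrightarrow>
     (\<forall>t\<ge>0. continuous (at_right t) f) \<and> (\<forall>t>0. \<exists>l. (f \<longlongrightarrow> l) (at_left t))"

text \<open>The time index is a real number, but only times \<open>t \<ge> 0\<close> are ever constrained or used.\<close>

definition levy_process :: "'a measure \<Rightarrow> (real \<Rightarrow> 'a \<Rightarrow> 'b::euclidean_space) \<Rightarrow> bool" where
  "levy_process M X \<longleftrightarrow>
     prob_space M \<and>
     (\<forall>t\<ge>0. X t \<in> borel_measurable M) \<and>
     (AE \<omega> in M. X 0 \<omega> = 0) \<and>
     (\<forall>(n::nat) ts. 0 \<le> ts 0 \<and> (\<forall>i<n. ts i < ts (Suc i)) \<longrightarrow>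
        prob_space.indep_vars M (\<lambda>_. borel) (\<lambda>i \<omega>. X (ts (Suc i)) \<omega> - X (ts i) \<omega>) {..<n}) \<and>
     (\<forall>s\<ge>0. \<forall>t\<ge>0. distr M borel (\<lambda>\<omega>. X (s + t) \<omega> - X s \<omega>) = distr M borel (X t)) \<and>
     (\<forall>t\<ge>0. \<forall>\<epsilon>>0.
        ((\<lambda>s. measure M {\<omega> \<in> space M. norm (X s \<omega> - X t \<omega>) > \<epsilon>}) \<longlongrightarrow> 0) (at t within {0..})) \<and>
     (AE \<omega> in M. cadlag (\<lambda>t. X t \<omega>))"

text \<open>Pure jump and absence of drift are expressed by the characteristic function: the Levy-Khintchine
  exponent has no Gaussian, drift or compensating term, and \<open>\<nu>\<close> is finite.\<close>

definition compound_poisson_process ::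
    "'a measure \<Rightarrow> 'b::euclidean_space measure \<Rightarrow> (real \<Rightarrow> 'a \<Rightarrow> 'b) \<Rightarrow> bool" where
  "compound_poisson_process M \<nu> X \<longleftrightarrow>
     finite_measure \<nu> \<and> sets \<nu> = sets borel \<and>
     levy_process M X \<and>
     (\<forall>t\<ge>0. \<forall>z. (\<integral>\<omega>. iexp (z \<bullet> X t \<omega>) \<partial>M) =
        exp (complex_of_real t * (\<integral>x. (iexp (z \<bullet> x) - 1) \<partial>\<nu>)))"

definition jump_measure :: "real \<Rightarrow> int \<Rightarrow> real \<Rightarrow> real \<Rightarrow> real \<Rightarrow> (real \<times> real) measure" where
  "jump_measure c k u v w =
     distr (point_measure {(1, 0), (0, 1), (1, c powi (- k))}
       ((\<lambda>_. 0)((1, 0) := ennreal u, (0, 1) := ennreal v, (1, c powi (- k)) := ennreal w)))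
     borel (\<lambda>x. x)"

text \<open>The law of the integral depends on \<open>u, v, w\<close> only through \<open>p, q, r\<close>, so the process is
  constrained only through these; any total jump rate \<open>u + v + w\<close> is admitted.\<close>

definition driving_process ::
    "real \<Rightarrow> real \<Rightarrow> real \<Rightarrow> real \<Rightarrow> int \<Rightarrow> 'a measure \<Rightarrow> (real \<Rightarrow> 'a \<Rightarrow> real) \<Rightarrow> (real \<Rightarrow> 'a \<Rightarrow> real) \<Rightarrow> bool"
  where
  "driving_process c p q r k M N L \<longleftrightarrow>
     (\<exists>u v w. u \<ge> 0 \<and> v \<ge> 0 \<and> w \<ge> 0 \<and> u + v + w > 0 \<and>
        p = u / (u + v + w) \<and> q = v / (u + v + w) \<and> r = w / (u + v + w) \<and>
        compound_poisson_process M (jump_measure c k u v w) (\<lambda>t \<omega>. (N t \<omega>, L t \<omega>)))"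

text \<open>The pathwise Lebesgue-Stieltjes integral of \<open>c powr (- N (s-))\<close> with respect to \<open>L\<close> over
  \<open>{0<..t}\<close>. All jumps of \<open>L\<close> are positive (of size 1 or \<open>c powi (- k)\<close>), so almost every path of
  \<open>L\<close> is nondecreasing and right-continuous, which is what \<open>interval_measure\<close> needs; the path is
  extended to negative times as a constant.\<close>

definition stieltjes_integral ::
    "real \<Rightarrow> (real \<Rightarrow> 'a \<Rightarrow> real) \<Rightarrow> (real \<Rightarrow> 'a \<Rightarrow> real) \<Rightarrow> real \<Rightarrow> 'a \<Rightarrow> real" where
  "stieltjes_integral c N L t \<omega> =
     (LINT s:{0<..t}|interval_measure (\<lambda>s. L (max 0 s) \<omega>).
        c powr (- Lim (at_left s) (\<lambda>y. N y \<omega>)))"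

text \<open>An almost sure limit is determined only up to null sets, and its distribution does not depend on
  the version. A measurable version is chosen here because the pointwise limit need not be measurable
  when \<open>M\<close> is not complete.\<close>

definition improper_integral ::
    "real \<Rightarrow> 'a measure \<Rightarrow> (real \<Rightarrow> 'a \<Rightarrow> real) \<Rightarrow> (real \<Rightarrow> 'a \<Rightarrow> real) \<Rightarrow> 'a \<Rightarrow> real" where
  "improper_integral c M N L =
     (SOME Y. Y \<in> borel_measurable M \<and>
        (AE \<omega> in M. ((\<lambda>t. stieltjes_integral c N L t \<omega>) \<longlongrightarrow> Y \<omega>) at_top))"

definition integral_law ::
    "real \<Rightarrow> 'a measure \<Rightarrow> (real \<Rightarrow> 'a \<Rightarrow> real) \<Rightarrow> (real \<Rightarrow> 'a \<Rightarrow> real) \<Rightarrow> real measure" where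
  "integral_law c M N L = distr M borel (improper_integral c M N L)"

definition convolution_power :: "nat \<Rightarrow> 'b::ordered_euclidean_space measure \<Rightarrow> 'b measure" where
  "convolution_power n \<rho> = ((\<lambda>\<sigma>. \<rho> \<star> \<sigma>) ^^ n) (return borel 0)"

definition infinitely_divisible :: "'b::ordered_euclidean_space measure \<Rightarrow> bool" where
  "infinitely_divisible \<mu> \<longleftrightarrow>
     prob_space \<mu> \<and> sets \<mu> = sets borel \<and>
     (\<forall>n\<ge>1. \<exists>\<rho>. prob_space \<rho> \<and> sets \<rho> = sets borel \<and> \<mu> = convolution_power n \<rho>)"

end

theory Submission
  imports Defs
begin

text \<open>Splitting the integral at the first jump of \<open>N\<close> shows that the characteristic function \<open>\<phi>\<close> of
  \<open>\<mu>\<^sup>(\<^sup>k\<^sup>)\<close> solves \<open>(1 - q e\<^sup>i\<^sup>z) \<phi> z = (p + r exp (i z c powi (- k))) \<phi> (z / c)\<close>, which has only one solution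
  that is continuous at 0 with value 1 there. If \<open>X\<close> has law \<open>\<mu>\<^sup>(\<^sup>k\<^sup>)\<close> and \<open>G\<close> is an independent geometric
  variable with parameter \<open>q\<close>, the characteristic function of \<open>X / c + G\<close> solves the equation for \<open>k + 1\<close>.
  So \<open>\<mu>\<^sup>(\<^sup>k\<^sup>+\<^sup>1\<^sup>)\<close> is the law of \<open>X / c + G\<close>, and infinite divisibility passes through scaling and through
  convolution with the geometric law, whose convolution roots are negative binomial laws.

  The jump times themselves are avoided: over a grid of mesh \<open>h\<close> the Riemann sums of the integral form a
  perpetuity with independent identically distributed increments, whose one-step recursion yields the
  equation after division by \<open>h\<close> as \<open>h \<rightarrow> 0\<close>.\<close>

section \<open>Characteristic functions and discrete laws\<close>

lemma real_distributionI_sets: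
  assumes "prob_space M" "sets M = sets borel"
  shows "real_distribution (M :: real measure)"
  using assms by (simp add: real_distribution_def real_distribution_axioms_def)

lemma char_eq_imp_eq:
  assumes "prob_space M1" "sets M1 = sets borel" "prob_space M2" "sets M2 = sets borel"
    and "\<And>z. char M1 z = char M2 z"
  shows "M1 = M2"
  using assms by (intro Levy_uniqueness real_distributionI_sets ext) auto

section \<open>Convolutions, convolution powers and their characteristic functions\<close>

lemma prob_space_convolution:
  assumes "prob_space M" "prob_space N" "sets M = sets borel" "sets N = sets borel"
  shows "prob_space (M \<star> N)"
proof -
  note [measurable_cong] = assms(3,4)
  interpret pair_prob_space M N
    using assms by (simp add: pair_prob_space_def pair_sigma_finite_def prob_space_imp_sigma_finite)
  show ?thesis
    unfolding convolution_def by (rule prob_space_distr) simp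
qed

lemma char_convolution:
  assumes "prob_space M" "prob_space N" "sets M = sets borel" "sets N = sets borel"
  shows "char (M \<star> N) z = char M z * char N z"
proof -
  note [measurable_cong] = assms(3,4)
  interpret M: prob_space M by fact
  interpret N: prob_space N by fact
  interpret pair_prob_space M N ..
  have [simp]: "integrable (M \<Otimes>\<^sub>M N) (\<lambda>x. iexp (z * (fst x + snd x)))"
    by (rule integrableI_bounded_set[where A="space (M \<Otimes>\<^sub>M N)" and B=1]) (auto simp: emeasure_space_1 simp del: of_real_mult of_real_add)
  have "char (M \<star> N) z = (CLINT x|M \<Otimes>\<^sub>M N. iexp (z * (fst x + snd x)))"
    unfolding char_def convolution_def by (subst integral_distr) (auto simp: case_prod_beta)
  also have "\<dots> = (CLINT x|M. (CLINT y|N. iexp (z * (x + y))))"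
    by (subst integral_fst'[symmetric]) (simp_all del: of_real_mult of_real_add)
  also have "\<dots> = (CLINT x|M. iexp (z * x) * (CLINT y|N. iexp (z * y)))"
    by (simp add: distrib_left exp_add)
  finally show ?thesis by (simp add: char_def)
qed

lemma convolution_power_props:
  assumes "prob_space \<rho>" "sets \<rho> = sets (borel :: real measure)"
  shows "prob_space (convolution_power n \<rho>)" "sets (convolution_power n \<rho>) = sets borel"
    and "char (convolution_power n \<rho>) z = char \<rho> z ^ n"
proof (induction n)
  case 0
  { case 1 show ?case by (simp add: convolution_power_def prob_space_return)
  next case 2 show ?case by (simp add: convolution_power_def)
  next case 3 show ?case by (simp add: convolution_power_def char_def integral_return) }
next
  case (Suc n)
  note [simp] = assms Suc
  have *: "convolution_power (Suc n) \<rho> = (\<rho> \<star> convolution_power n \<rho>)"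
    by (simp add: convolution_power_def)
  { case 1 show ?case by (simp add: * prob_space_convolution)
  next case 2 show ?case by (simp add: *)
  next case 3 show ?case by (simp add: * char_convolution) }
qed

section \<open>Laws on the natural numbers: Poisson and negative binomial\<close>

lemma sums_expectation_nat_pmf:
  fixes p :: "nat pmf" and g :: "nat \<Rightarrow> 'a::{banach, second_countable_topology}"
  assumes "integrable (measure_pmf p) g"
  shows "(\<lambda>k. pmf p k *\<^sub>R g k) sums measure_pmf.expectation p g"
proof -
  have "integrable (count_space UNIV) (\<lambda>k. pmf p k *\<^sub>R g k)"
    using assms by (subst (asm) measure_pmf_eq_density, subst (asm) integrable_density) auto
  then show ?thesis
    using sums_integral_count_space_nat[of "\<lambda>k. pmf p k *\<^sub>R g k"]
    by (subst measure_pmf_eq_density, subst integral_density) auto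
qed

lemma pmf_embed_nat_pmf:
  fixes f :: "nat \<Rightarrow> real"
  assumes "\<And>k. 0 \<le> f k" "f sums 1"
  shows "pmf (embed_pmf f) k = f k"
  using assms
  by (intro pmf_embed_pmf) (auto simp: nn_integral_count_space_nat suminf_ennreal_eq[OF assms])

definition real_pmf_law :: "nat pmf \<Rightarrow> real measure" where
  "real_pmf_law p = distr (measure_pmf p) borel real"

lemma real_pmf_law_props [simp]:
  "prob_space (real_pmf_law p)" "sets (real_pmf_law p) = sets borel"
  by (simp_all add: real_pmf_law_def prob_space.prob_space_distr prob_space_measure_pmf)

text \<open>Characteristic functions of discrete laws are computed by matching this power series in
  \<open>iexp z\<close> with a known one: the exponential series or the binomial series.\<close>

lemma sums_char_real_pmf_law:
  "(\<lambda>k. of_real (pmf p k) * iexp z ^ k) sums char (real_pmf_law p) z"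
proof -
  have "integrable (measure_pmf p) (\<lambda>k. iexp z ^ k)"
    by (rule measure_pmf.integrable_const_bound[where B=1]) (auto simp: norm_power)
  moreover have "char (real_pmf_law p) z = measure_pmf.expectation p (\<lambda>k. iexp z ^ k)"
    unfolding char_def real_pmf_law_def
    by (subst integral_distr) (auto simp flip: exp_of_nat_mult intro!: Bochner_Integration.integral_cong simp: mult_ac)
  ultimately show ?thesis
    using sums_expectation_nat_pmf[of p "\<lambda>k. iexp z ^ k"] by (simp add: scaleR_conv_of_real)
qed

definition poisson_law :: "real \<Rightarrow> nat pmf" where
  "poisson_law a = embed_pmf (\<lambda>k. a ^ k / fact k * exp (- a))"

lemma pmf_poisson_law:
  assumes "0 \<le> a"
  shows "pmf (poisson_law a) k = a ^ k / fact k * exp (- a)"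
  unfolding poisson_law_def
proof (rule pmf_embed_nat_pmf)
  show "(\<lambda>k. a ^ k / fact k * exp (- a)) sums 1"
    using sums_mult2[OF exp_converges[of a], of "exp (- a)"]
    by (simp add: exp_minus field_simps)
qed (use assms in simp)

lemma char_poisson_law:
  assumes "0 \<le> a"
  shows "char (real_pmf_law (poisson_law a)) z = exp (of_real a * (iexp z - 1))"
proof -
  have "(\<lambda>k. of_real (pmf (poisson_law a) k) * iexp z ^ k) sums (exp (of_real a * iexp z) * exp (- of_real a))"
    using sums_mult2[OF exp_converges[of "of_real a * iexp z"], of "exp (- of_real a)"]
    by (simp add: pmf_poisson_law assms scaleR_conv_of_real power_mult_distrib exp_of_real[symmetric] field_simps)
  with sums_char_real_pmf_law[of "poisson_law a" z] have
    "char (real_pmf_law (poisson_law a)) z = exp (of_real a * iexp z) * exp (- of_real a)"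
    by (rule sums_unique2)
  then show ?thesis by (simp add: exp_add[symmetric] algebra_simps)
qed

text \<open>The probability generating function; at \<open>x = 1 / c\<close> it gives the mean of
  the discount factor.\<close>

lemma expectation_power_poisson_law:
  assumes "0 \<le> a" "0 \<le> x" "x \<le> 1"
  shows "measure_pmf.expectation (poisson_law a) (\<lambda>k. x ^ k) = exp (- a * (1 - x))"
proof -
  have "integrable (measure_pmf (poisson_law a)) (\<lambda>k. x ^ k)"
    using assms by (intro measure_pmf.integrable_const_bound[where B=1]) (auto simp: power_le_one)
  then have "(\<lambda>k. pmf (poisson_law a) k *\<^sub>R x ^ k) sums measure_pmf.expectation (poisson_law a) (\<lambda>k. x ^ k)"
    by (rule sums_expectation_nat_pmf)
  moreover have "(\<lambda>k. pmf (poisson_law a) k *\<^sub>R x ^ k) sums (exp (a * x) * exp (- a))"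
    using sums_mult2[OF exp_converges[of "a * x"], of "exp (- a)"]
    by (simp add: pmf_poisson_law assms power_mult_distrib field_simps)
  ultimately have "measure_pmf.expectation (poisson_law a) (\<lambda>k. x ^ k) = exp (a * x) * exp (- a)"
    by (rule sums_unique2)
  then show ?thesis by (simp add: exp_add[symmetric] algebra_simps)
qed

lemma nn_integral_poisson_law:
  assumes "0 \<le> a"
  shows "(\<integral>\<^sup>+k. ennreal (real k) \<partial>measure_pmf (poisson_law a)) = ennreal a"
proof -
  have *: "(\<lambda>k. (a ^ k / fact k * exp (- a)) * real k) sums a"
  proof -
    \<comment> \<open>The term \<open>k = 0\<close> of the mean vanishes; in the others
      \<open>k\<close> cancels against the factorial, which leaves \<open>a\<close> times the
      shifted Poisson series.\<close>
    have "(\<lambda>k. a ^ k / fact k * (a * exp (- a))) sums a"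
      using sums_mult2[OF exp_converges[of a], of "a * exp (- a)"]
      by (simp add: exp_minus field_simps)
    moreover have "a ^ k / fact k * (a * exp (- a)) = a ^ Suc k / fact (Suc k) * exp (- a) * real (Suc k)" for k
      by (simp add: field_simps del: of_nat_Suc)
    ultimately have "(\<lambda>k. a ^ Suc k / fact (Suc k) * exp (- a) * real (Suc k)) sums a"
      by (simp only:)
    then show ?thesis by (subst (asm) sums_Suc_iff) simp
  qed
  have "(\<integral>\<^sup>+k. ennreal (real k) \<partial>measure_pmf (poisson_law a))
      = (\<Sum>k. ennreal ((a ^ k / fact k * exp (- a)) * real k))"
    using assms
    by (simp add: nn_integral_measure_pmf nn_integral_count_space_nat pmf_poisson_law ennreal_mult[symmetric])
  also have "\<dots> = ennreal a"
    using * assms by (intro suminf_ennreal_eq) auto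
  finally show ?thesis .
qed

lemma measure_poisson_law_ge_2:
  assumes "0 \<le> a"
  shows "measure (measure_pmf (poisson_law a)) {2..} = 1 - exp (- a) * (1 + a)"
proof -
  have "measure (measure_pmf (poisson_law a)) {2..} = 1 - measure (measure_pmf (poisson_law a)) {0,1}"
    by (subst measure_pmf.prob_compl[symmetric]) (auto intro!: arg_cong[where f="measure _"])
  also have "measure (measure_pmf (poisson_law a)) {0,1} = exp (- a) * (1 + a)"
    using assms by (subst measure_measure_pmf_finite) (auto simp: pmf_poisson_law algebra_simps)
  finally show ?thesis .
qed

text \<open>The negative binomial law with real size \<open>s\<close>: its weights are the
  coefficients of \<open>(1 - q x) powr (- s)\<close>, normalised. Size 1 is the geometric law, and
  size \<open>1 / n\<close> is its \<open>n\<close>-th convolution root.\<close>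

definition neg_binomial_law :: "real \<Rightarrow> real \<Rightarrow> nat pmf" where
  "neg_binomial_law s q = embed_pmf (\<lambda>k. ((- s) gchoose k) * (- q) ^ k * (1 - q) powr s)"

lemma pmf_neg_binomial_law:
  assumes "0 \<le> s" "0 \<le> q" "q < 1"
  shows "pmf (neg_binomial_law s q) k = ((- s) gchoose k) * (- q) ^ k * (1 - q) powr s"
  unfolding neg_binomial_law_def
proof (rule pmf_embed_nat_pmf)
  show "0 \<le> ((- s) gchoose k) * (- q) ^ k * (1 - q) powr s" for k
  proof -
    \<comment> \<open>The signs of the binomial coefficient and of \<open>(- q) ^ k\<close> cancel,
      leaving a rising factorial of a nonnegative number.\<close>
    have "((- s) gchoose k) * (- q) ^ k = pochhammer s k / fact k * q ^ k"
      by (simp add: gbinomial_pochhammer flip: power_mult_distrib)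
    moreover have "0 \<le> pochhammer s k"
      using assms(1) by (auto simp: pochhammer_prod intro!: prod_nonneg)
    ultimately show ?thesis using assms(2) by simp
  qed
  show "(\<lambda>k. ((- s) gchoose k) * (- q) ^ k * (1 - q) powr s) sums 1"
    using sums_mult2[OF gen_binomial_real[of "- q" "- s"], of "(1 - q) powr s"] assms
    by (simp add: powr_add[symmetric])
qed

lemma gbinomial_of_real:
  "complex_of_real (a gchoose k) = complex_of_real a gchoose k"
  by (simp add: gbinomial_prod_rev)

lemma char_neg_binomial_law:
  assumes "0 < n" "0 \<le> q" "q < 1"
  shows "char (real_pmf_law (neg_binomial_law (1 / real n) q)) z ^ n = of_real (1 - q) / (1 - of_real q * iexp z)"
proof -
  define s where "s = 1 / real n"
  have s: "0 \<le> s" by (simp add: s_def)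
  have n: "norm (- of_real q * iexp z) < 1"
    using assms by (simp add: norm_mult)
  then have nz: "1 + - of_real q * iexp z \<noteq> 0"
    by (metis add_eq_0_iff norm_minus_cancel norm_one order_less_irrefl)
  have "(\<lambda>k. of_real (pmf (neg_binomial_law s q) k) * iexp z ^ k) sums
     ((1 + - of_real q * iexp z) powr (- of_real s) * of_real ((1 - q) powr s))"
    using sums_mult2[OF gen_binomial_complex[OF n, of "- of_real s"], of "of_real ((1 - q) powr s)"]
    by (simp add: pmf_neg_binomial_law[OF s assms(2,3)] gbinomial_of_real power_mult_distrib 
       algebra_simps flip: of_real_minus of_real_power)
  with sums_char_real_pmf_law[of "neg_binomial_law s q" z] have
    "char (real_pmf_law (neg_binomial_law s q)) z = (1 + - of_real q * iexp z) powr (- of_real s) * of_real ((1 - q) powr s)"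
    by (rule sums_unique2)
  moreover have "((1 - q) powr s) ^ n = 1 - q"
    using assms by (simp add: s_def powr_powr flip: powr_realpow)
  \<comment> \<open>The complex power is \<open>exp\<close> of a multiple of one fixed logarithm, so
    the \<open>n\<close>-th power with \<open>s = 1 / n\<close> recovers the inverse of the base
    whatever the branch.\<close>
  moreover have "((1 + - of_real q * iexp z) powr (- of_real s)) ^ n = 1 / (1 + - of_real q * iexp z)"
    using nz assms(1) by (simp add: powr_def exp_of_nat_mult[symmetric] s_def exp_minus field_simps)
  ultimately show ?thesis
    by (simp add: power_mult_distrib s_def flip: of_real_power)
qed

text \<open>The hypothesis on characteristic functions says that \<open>\<mu>'\<close> is the law of
  \<open>a X + G\<close> with \<open>X\<close> of law \<open>\<mu>\<close> and \<open>G\<close> an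
  independent geometric variable. An \<open>n\<close>-th root is the convolution of the negative
  binomial law of size \<open>1 / n\<close> with the \<open>n\<close>-th root of
  \<open>\<mu>\<close> scaled by \<open>a\<close>.\<close>

lemma infinitely_divisible_scale_geometric:
  fixes \<mu> \<mu>' :: "real measure" and q a :: real
  assumes "infinitely_divisible \<mu>" "prob_space \<mu>'" "sets \<mu>' = sets borel" "0 \<le> q" "q < 1"
    and char: "\<And>z. char \<mu>' z = of_real (1 - q) / (1 - of_real q * iexp z) * char \<mu> (a * z)"
  shows "infinitely_divisible \<mu>'"
  unfolding infinitely_divisible_def
proof (intro conjI allI impI assms)
  fix n :: nat assume n: "1 \<le> n"
  from assms(1) n obtain \<rho> where \<rho>: "prob_space \<rho>" "sets \<rho> = sets borel" "\<mu> = convolution_power n \<rho>"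
    unfolding infinitely_divisible_def by blast
  note [measurable_cong] = \<rho>(2)
  define \<rho>' where "\<rho>' = (real_pmf_law (neg_binomial_law (1 / real n) q) \<star> distr \<rho> borel ((*) a))"
  have d: "prob_space (distr \<rho> borel ((*) a))"
    using \<rho>(1) by (intro prob_space.prob_space_distr) auto
  have *: "prob_space \<rho>'" "sets \<rho>' = sets borel"
    using d by (simp_all add: \<rho>'_def prob_space_convolution)
  have "char (distr \<rho> borel ((*) a)) z = char \<rho> (a * z)" for z
    unfolding char_def by (subst integral_distr) (auto simp: algebra_simps)
  then have "char \<mu>' z = char \<rho>' z ^ n" for z
    using d n assms(4,5)
    by (simp add: \<rho>'_def char_convolution power_mult_distrib char_neg_binomial_law char \<rho>(3)
        convolution_power_props[OF \<rho>(1,2)])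
  then have "\<mu>' = convolution_power n \<rho>'"
    using assms(2,3) convolution_power_props[OF *] by (intro char_eq_imp_eq) auto
  with * show "\<exists>\<rho>. prob_space \<rho> \<and> sets \<rho> = sets borel \<and> \<mu>' = convolution_power n \<rho>" by blast
qed

section \<open>The driving process\<close>

lemma integral_jump_measure:
  fixes g :: "real \<times> real \<Rightarrow> complex"
  assumes "c > 0" "u \<ge> 0" "v \<ge> 0" "w \<ge> 0" and [measurable]: "g \<in> borel_measurable borel"
  shows "(\<integral>x. g x \<partial>jump_measure c k u v w) = u * g (1, 0) + v * g (0, 1) + w * g (1, c powi (- k))"
proof -
  define d where "d = c powi (- k)"
  \<comment> \<open>Since \<open>d\<close> is nonzero, \<open>(1, d)\<close> differs from
    \<open>(1, 0)\<close>; otherwise the function update would overwrite the mass \<open>u\<close>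
    by \<open>w\<close>.\<close>
  have d: "d > 0" using assms(1) by (simp add: d_def)
  define f where "f = (\<lambda>_::real\<times>real. 0::real)((1, 0) := u, (0, 1) := v, (1, d) := w)"
  have f: "((\<lambda>_. 0)((1, 0) := ennreal u, (0, 1) := ennreal v, (1, d) := ennreal w)) = (\<lambda>x. ennreal (f x))"
    by (auto simp: f_def)
  have f0: "f x \<ge> 0" for x using assms by (auto simp: f_def)
  have "(\<integral>x. g x \<partial>jump_measure c k u v w) = (\<integral>x. g x \<partial>point_measure {(1, 0), (0, 1), (1, d)} f)"
    unfolding jump_measure_def d_def[symmetric] f
    by (intro integral_distr assms) (auto simp: measurable_def sets_point_measure space_point_measure)
  also have "\<dots> = (\<Sum>a\<in>{(1, 0), (0, 1), (1, d)}. f a *\<^sub>R g a)"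
    using f0 by (intro lebesgue_integral_point_measure_finite) auto
  also have "\<dots> = u * g (1, 0) + v * g (0, 1) + w * g (1, d)"
    using d by (simp add: f_def scaleR_conv_of_real)
  finally show ?thesis by (simp add: d_def)
qed

text \<open>Carries relations that hold almost surely at all rational times over to all
  times.\<close>

lemma right_continuous_rational_seq:
  fixes f :: "real \<Rightarrow> 'b::topological_space"
  assumes "continuous (at_right t) f"
  obtains r where "\<And>n. r n \<in> \<rat>" "\<And>n. r n > t" "r \<longlonglongrightarrow> t" "(\<lambda>n. f (r n)) \<longlonglongrightarrow> f t"
proof -
  have "\<exists>q\<in>\<rat>. t < q \<and> q < t + 1 / real (Suc n)" for n
    by (rule Rats_dense_in_real) simp
  then obtain r where r: "\<And>n. r n \<in> \<rat>" "\<And>n. t < r n" "\<And>n. r n < t + 1 / real (Suc n)" by metis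
  have lim: "r \<longlonglongrightarrow> t"
  proof (rule tendsto_sandwich[OF _ _ tendsto_const])
    show "(\<lambda>n. t + inverse (real (Suc n))) \<longlonglongrightarrow> t"
      using tendsto_add[OF tendsto_const[of t] LIMSEQ_inverse_real_of_nat] by simp
    show "\<forall>\<^sub>F n in sequentially. t \<le> r n"
      using r(2) by (auto intro!: always_eventually less_imp_le)
    show "\<forall>\<^sub>F n in sequentially. r n \<le> t + inverse (real (Suc n))"
      using r(3) by (auto intro!: always_eventually less_imp_le simp: inverse_eq_divide simp del: of_nat_Suc)
  qed
  have "filterlim r (at_right t) sequentially"
    using lim r(2) by (auto simp: filterlim_at intro!: always_eventually)
  then have "(\<lambda>n. f (r n)) \<longlonglongrightarrow> f t"
    using assms filterlim_compose[of f "nhds (f t)" "at_right t" r sequentially]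
    by (simp add: continuous_within)
  with r lim that show ?thesis by blast
qed

lemma cadlag_fst: "cadlag f \<Longrightarrow> cadlag (\<lambda>t. fst (f t))"
  unfolding cadlag_def by (blast intro: continuous_fst tendsto_fst)

lemma cadlag_snd: "cadlag f \<Longrightarrow> cadlag (\<lambda>t. snd (f t))"
  unfolding cadlag_def by (blast intro: continuous_snd tendsto_snd)

text \<open>The sum \<open>u + w\<close> is the jump rate of \<open>N\<close>. Its positivity
  corresponds to \<open>p + r > 0\<close> and makes the discount factor decay, so that the integral
  converges.\<close>

locale gou_process = prob_space M
  for M :: "'a measure" and N L :: "real \<Rightarrow> 'a \<Rightarrow> real" and c u v w :: real and k :: int +
  assumes c: "c > 1" and u: "u \<ge> 0" and v: "v \<ge> 0" and w: "w \<ge> 0" and uw: "u + w > 0"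
    and process: "compound_poisson_process M (jump_measure c k u v w) (\<lambda>t \<omega>. (N t \<omega>, L t \<omega>))"
begin

definition d :: real where "d = c powi (- k)"

text \<open>The Levy exponent of the pair \<open>(N, L)\<close> at \<open>(a, b)\<close>.\<close>

definition jump_exponent :: "real \<Rightarrow> real \<Rightarrow> complex" where
  "jump_exponent a b = u * (iexp a - 1) + v * (iexp b - 1) + w * (iexp (a + b * d) - 1)"

lemma d_pos: "d > 0" using c by (simp add: d_def)

lemma levy: "levy_process M (\<lambda>t \<omega>. (N t \<omega>, L t \<omega>))"
  using process by (simp add: compound_poisson_process_def)

lemma measurable_process:
  assumes "0 \<le> t"
  shows "(\<lambda>\<omega>. (N t \<omega>, L t \<omega>)) \<in> borel_measurable M" "N t \<in> borel_measurable M" "L t \<in> borel_measurable M"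
proof -
  show X: "(\<lambda>\<omega>. (N t \<omega>, L t \<omega>)) \<in> borel_measurable M"
    using levy assms by (simp add: levy_process_def)
  have "(\<lambda>\<omega>. fst (N t \<omega>, L t \<omega>)) \<in> borel_measurable M" "(\<lambda>\<omega>. snd (N t \<omega>, L t \<omega>)) \<in> borel_measurable M"
    using X unfolding borel_prod[symmetric] by (auto intro: measurable_compose[OF X[unfolded borel_prod[symmetric]]])
  then show "N t \<in> borel_measurable M" "L t \<in> borel_measurable M" by simp_all
qed

section \<open>Laws and means at a fixed time\<close>

lemma joint_char:
  assumes "0 \<le> t"
  shows "(\<integral>\<omega>. iexp (a * N t \<omega> + b * L t \<omega>) \<partial>M) = exp (t * jump_exponent a b)"
proof -
  have "(\<integral>\<omega>. iexp ((a, b) \<bullet> (N t \<omega>, L t \<omega>)) \<partial>M) =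
        exp (complex_of_real t * (\<integral>x. (iexp ((a, b) \<bullet> x) - 1) \<partial>jump_measure c k u v w))"
    using process assms unfolding compound_poisson_process_def by blast
  then show ?thesis
    using c u v w by (subst (asm) integral_jump_measure) (auto simp: jump_exponent_def d_def simp del: of_real_mult of_real_add)
qed

lemma distr_N:
  assumes "0 \<le> t"
  shows "distr M borel (N t) = real_pmf_law (poisson_law (t * (u + w)))"
proof (rule char_eq_imp_eq)
  note [measurable] = measurable_process[OF assms]
  have a: "0 \<le> t * (u + w)" using assms uw by simp
  show "prob_space (distr M borel (N t))" by (rule prob_space_distr) simp
  fix z
  have "char (distr M borel (N t)) z = (\<integral>\<omega>. iexp (z * N t \<omega> + 0 * L t \<omega>) \<partial>M)"
    unfolding char_def by (subst integral_distr) auto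
  also have "\<dots> = exp (t * jump_exponent z 0)" by (rule joint_char[OF assms])
  also have "\<dots> = char (real_pmf_law (poisson_law (t * (u + w)))) z"
    using a by (simp add: char_poisson_law jump_exponent_def algebra_simps)
  finally show "char (distr M borel (N t)) z = char (real_pmf_law (poisson_law (t * (u + w)))) z" .
qed simp_all

text \<open>The jumps of \<open>L\<close> of size 1 and those of size \<open>d\<close> are counted
  by independent Poisson variables, with rates \<open>v\<close> and \<open>w\<close>; the exponent
  splits accordingly.\<close>

lemma distr_L:
  assumes "0 \<le> t"
  shows "distr M borel (L t) =
    (real_pmf_law (poisson_law (t * v)) \<star> distr (real_pmf_law (poisson_law (t * w))) borel ((*) d))"
    (is "_ = (?A \<star> ?B)")
proof (rule char_eq_imp_eq)
  note [measurable] = measurable_process[OF assms]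
  have a: "0 \<le> t * v" "0 \<le> t * w" using assms v w by simp_all
  show "prob_space (distr M borel (L t))" by (rule prob_space_distr) simp
  have B: "prob_space ?B" by (rule prob_space.prob_space_distr) (auto simp: measurable_cong_sets[OF real_pmf_law_props(2) refl])
  then show "prob_space (?A \<star> ?B)" by (simp add: prob_space_convolution)
  fix z
  have cB: "char ?B z = char (real_pmf_law (poisson_law (t * w))) (z * d)"
    unfolding char_def by (subst integral_distr) (auto simp: measurable_cong_sets[OF real_pmf_law_props(2) refl] mult_ac)
  have "char (distr M borel (L t)) z = (\<integral>\<omega>. iexp (0 * N t \<omega> + z * L t \<omega>) \<partial>M)"
    unfolding char_def by (subst integral_distr) auto
  also have "\<dots> = exp (t * jump_exponent 0 z)" by (rule joint_char[OF assms])
  also have "\<dots> = char (?A \<star> ?B) z"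
    using a B by (simp add: char_convolution cB char_poisson_law jump_exponent_def distrib_left mult_ac flip: exp_add)
  finally show "char (distr M borel (L t)) z = char (?A \<star> ?B) z" .
qed simp_all

lemma AE_N_nat:
  assumes "0 \<le> t"
  shows "AE \<omega> in M. N t \<omega> \<in> range real"
proof -
  note [measurable] = measurable_process[OF assms]
  have m: "{x \<in> space borel. x \<in> range real} \<in> sets borel"
    using sets.countable[of "range real" borel] by (simp add: borel_closed)
  have "AE x in distr M borel (N t). x \<in> range real"
    unfolding distr_N[OF assms] real_pmf_law_def by (subst AE_distr_iff[OF _ m]) simp_all
  then show ?thesis by (subst (asm) AE_distr_iff[OF _ m]) simp_all
qed

lemma prob_N_ge_2:
  assumes "0 \<le> t"
  shows "measure M {\<omega> \<in> space M. 2 \<le> N t \<omega>} = 1 - exp (- (t * (u + w))) * (1 + t * (u + w))"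
proof -
  note [measurable] = measurable_process[OF assms]
  have "measure M {\<omega> \<in> space M. 2 \<le> N t \<omega>} = measure (distr M borel (N t)) {2..}"
    by (subst measure_distr) (auto intro!: arg_cong[where f="measure M"])
  also have "\<dots> = measure (measure_pmf (poisson_law (t * (u + w)))) {2..}"
    unfolding distr_N[OF assms] real_pmf_law_def
    by (subst measure_distr) (auto intro!: arg_cong[where f="measure _"])
  finally show ?thesis using assms uw by (simp add: measure_poisson_law_ge_2)
qed

lemma discount_le_1: "0 \<le> x \<Longrightarrow> c powr (- x) \<le> 1"
  using c powr_mono[of "- x" 0 c] by simp

text \<open>The exponential rate at which the mean of \<open>c powr (- N t)\<close> decays, read off
  from the Poisson generating function at \<open>1 / c\<close>.\<close>

definition decay_rate :: real where "decay_rate = (u + w) * (1 - 1 / c)"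

lemma decay_rate_pos: "decay_rate > 0" using c uw by (simp add: decay_rate_def)

lemma expectation_discount:
  assumes "0 \<le> t"
  shows "integrable M (\<lambda>\<omega>. c powr (- N t \<omega>))" "(\<integral>\<omega>. c powr (- N t \<omega>) \<partial>M) = exp (- decay_rate * t)"
proof -
  note [measurable] = measurable_process[OF assms]
  show "integrable M (\<lambda>\<omega>. c powr (- N t \<omega>))"
    using AE_N_nat[OF assms]
    by (intro integrable_const_bound[where B=1]) (auto simp: discount_le_1 elim!: eventually_mono)
  have "(\<integral>\<omega>. c powr (- N t \<omega>) \<partial>M) = (\<integral>x. c powr (- x) \<partial>distr M borel (N t))"
    by (subst integral_distr) auto
  also have "\<dots> = measure_pmf.expectation (poisson_law (t * (u + w))) (\<lambda>j. (1 / c) ^ j)"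
    using c unfolding distr_N[OF assms] real_pmf_law_def
    by (subst integral_distr) (auto simp: powr_minus powr_realpow power_one_over inverse_eq_divide intro!: Bochner_Integration.integral_cong)
  also have "\<dots> = exp (- decay_rate * t)"
    using c uw assms by (subst expectation_power_poisson_law) (auto simp: decay_rate_def mult_ac)
  finally show "(\<integral>\<omega>. c powr (- N t \<omega>) \<partial>M) = exp (- decay_rate * t)" .
qed

lemma nn_integral_L:
  assumes "0 \<le> t"
  shows "(\<integral>\<^sup>+\<omega>. ennreal (L t \<omega>) \<partial>M) = ennreal (t * (v + w * d))"
    and "AE \<omega> in M. 0 \<le> L t \<omega>"
proof -
  note [measurable] = measurable_process[OF assms]
  let ?A = "real_pmf_law (poisson_law (t * v))" and ?B = "distr (real_pmf_law (poisson_law (t * w))) borel ((*) d)"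
  have m[measurable]: "(*) d \<in> measurable (real_pmf_law (poisson_law (t * w))) borel"
    by (simp add: measurable_cong_sets[OF real_pmf_law_props(2) refl])
  have a: "0 \<le> t * v" "0 \<le> t * w" using assms v w by simp_all
  have B: "prob_space ?B" by (rule prob_space.prob_space_distr) auto
  have fin: "finite_measure ?A" "finite_measure ?B"
    using B by (auto intro: prob_space.finite_measure)
  \<comment> \<open>Both claims are instances of this formula: \<open>f = ennreal\<close> gives the
    mean, and the indicator of the negative half-line gives the sign.\<close>
  have cnv: "(\<integral>\<^sup>+\<omega>. f (L t \<omega>) \<partial>M) = (\<integral>\<^sup>+i. \<integral>\<^sup>+j. f (real i + d * real j) \<partial>poisson_law (t * w) \<partial>poisson_law (t * v))"
    if [measurable]: "f \<in> borel_measurable borel" for f :: "real \<Rightarrow> ennreal"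
  proof -
    have "(\<integral>\<^sup>+\<omega>. f (L t \<omega>) \<partial>M) = (\<integral>\<^sup>+x. f x \<partial>distr M borel (L t))"
      by (subst nn_integral_distr) auto
    also have "\<dots> = (\<integral>\<^sup>+x. \<integral>\<^sup>+y. f (x + y) \<partial>?B \<partial>?A)"
      unfolding distr_L[OF assms] using fin by (subst nn_integral_convolution) auto
    also have "\<dots> = (\<integral>\<^sup>+x. \<integral>\<^sup>+j. f (x + d * real j) \<partial>poisson_law (t * w) \<partial>?A)"
      unfolding real_pmf_law_def by (simp add: nn_integral_distr distr_distr)
    also have "\<dots> = (\<integral>\<^sup>+i. \<integral>\<^sup>+j. f (real i + d * real j) \<partial>poisson_law (t * w) \<partial>poisson_law (t * v))"
      unfolding real_pmf_law_def by (simp add: nn_integral_distr)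
    finally show ?thesis .
  qed
  have "(\<integral>\<^sup>+\<omega>. ennreal (L t \<omega>) \<partial>M) =
    (\<integral>\<^sup>+i. \<integral>\<^sup>+j. ennreal (real i) + ennreal d * ennreal (real j) \<partial>poisson_law (t * w) \<partial>poisson_law (t * v))"
    using d_pos by (subst cnv) (auto simp: ennreal_mult)
  also have "\<dots> = ennreal (t * v) + ennreal d * ennreal (t * w)"
    using a by (simp add: nn_integral_add nn_integral_cmult nn_integral_poisson_law measure_pmf.emeasure_space_1[simplified])
  also have "\<dots> = ennreal (t * (v + w * d))"
    using a d_pos mult_nonneg_nonneg[of d "t * w"] ennreal_plus[of "t * v" "d * (t * w)"]
    by (simp add: ennreal_mult[symmetric] distrib_left mult_ac del: ennreal_plus)
  finally show "(\<integral>\<^sup>+\<omega>. ennreal (L t \<omega>) \<partial>M) = ennreal (t * (v + w * d))" .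
  have "(\<integral>\<^sup>+\<omega>. indicator {..<0} (L t \<omega>) \<partial>M) = 0"
    using d_pos by (subst cnv) (auto simp: nn_integral_0_iff_AE not_less)
  then show "AE \<omega> in M. 0 \<le> L t \<omega>"
    by (subst (asm) nn_integral_0_iff_AE) (auto simp: indicator_def not_less split: if_splits elim!: AE_mp)
qed

section \<open>Stationary increments and regularity of paths\<close>

lemma distr_increment:
  assumes "0 \<le> s" "0 \<le> t"
  shows "distr M borel (\<lambda>\<omega>. (N (s + t) \<omega> - N s \<omega>, L (s + t) \<omega> - L s \<omega>)) = distr M borel (\<lambda>\<omega>. (N t \<omega>, L t \<omega>))"
  using levy assms by (simp add: levy_process_def)

lemma AE_increment:
  assumes "0 \<le> s" "s \<le> t" and P[measurable]: "Measurable.pred borel (\<lambda>x. P (fst x) (snd x))"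
    and "AE \<omega> in M. P (N (t - s) \<omega>) (L (t - s) \<omega>)"
  shows "AE \<omega> in M. P (N t \<omega> - N s \<omega>) (L t \<omega> - L s \<omega>)"
proof -
  have st: "0 \<le> t" "0 \<le> t - s" using assms by auto
  note [measurable] = measurable_process[OF assms(1)] measurable_process[OF st(1)] measurable_process[OF st(2)]
  have "AE x in distr M borel (\<lambda>\<omega>. (N (t - s) \<omega>, L (t - s) \<omega>)). P (fst x) (snd x)"
    using assms(4) by (subst AE_distr_iff) auto
  moreover have "distr M borel (\<lambda>\<omega>. (N t \<omega> - N s \<omega>, L t \<omega> - L s \<omega>)) = distr M borel (\<lambda>\<omega>. (N (t - s) \<omega>, L (t - s) \<omega>))"
    using distr_increment[OF assms(1) st(2)] by simp
  ultimately have "AE x in distr M borel (\<lambda>\<omega>. (N t \<omega> - N s \<omega>, L t \<omega> - L s \<omega>)). P (fst x) (snd x)"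
    by (simp only:)
  then show ?thesis
    using P by (subst (asm) AE_distr_iff) (simp_all add: pred_def borel_measurable_Pair)
qed

text \<open>Collects the path properties used below, so that all pathwise arguments take place on
  one almost sure event. Nonnegativity of \<open>N\<close> bounds the discount factor by 1;
  monotonicity of \<open>L\<close> makes the Stieltjes measure available.\<close>

definition regular_path :: "'a \<Rightarrow> bool" where
  "regular_path \<omega> \<longleftrightarrow> N 0 \<omega> = 0 \<and> cadlag (\<lambda>t. N t \<omega>) \<and> cadlag (\<lambda>t. L t \<omega>) \<and> (\<forall>t\<ge>0. 0 \<le> N t \<omega>)
     \<and> (\<forall>s t. 0 \<le> s \<longrightarrow> s \<le> t \<longrightarrow> L s \<omega> \<le> L t \<omega>)"

text \<open>The fixed-time statements hold simultaneously at the countably many rational times, and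
  right continuity extends them to all times.\<close>

lemma AE_regular_path: "AE \<omega> in M. regular_path \<omega>"
proof -
  have "AE \<omega> in M. \<forall>s\<in>\<rat> \<inter> {0..}. N s \<omega> \<in> range real"
    by (intro AE_ball_countable' countable_Int1 countable_rat AE_N_nat) auto
  moreover have "AE \<omega> in M. \<forall>s\<in>\<rat> \<inter> {0..}. \<forall>t\<in>\<rat> \<inter> {s..}. L s \<omega> \<le> L t \<omega>"
  proof (intro AE_ball_countable' countable_Int1 countable_rat)
    fix s t :: real assume st: "s \<in> \<rat> \<inter> {0..}" "t \<in> \<rat> \<inter> {s..}"
    then have "AE \<omega> in M. 0 \<le> L (t - s) \<omega>" by (intro nn_integral_L) auto
    then have "AE \<omega> in M. 0 \<le> L t \<omega> - L s \<omega>"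
      using st by (intro AE_increment[where P="\<lambda>x y. 0 \<le> y"]) (auto simp: borel_prod[symmetric])
    then show "AE \<omega> in M. L s \<omega> \<le> L t \<omega>" by simp
  qed
  moreover have "AE \<omega> in M. (N 0 \<omega>, L 0 \<omega>) = 0" "AE \<omega> in M. cadlag (\<lambda>t. (N t \<omega>, L t \<omega>))"
    using levy by (simp_all add: levy_process_def)
  ultimately show ?thesis
  proof eventually_elim
    case (elim \<omega>)
    have cl: "cadlag (\<lambda>t. N t \<omega>)" "cadlag (\<lambda>t. L t \<omega>)"
      using cadlag_fst[OF elim(4)] cadlag_snd[OF elim(4)] by simp_all
    have "0 \<le> N t \<omega>" if t: "0 \<le> t" for t
    proof -
      obtain r where r: "\<And>n. r n \<in> \<rat>" "\<And>n. r n > t" "(\<lambda>n. N (r n) \<omega>) \<longlonglongrightarrow> N t \<omega>"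
        using right_continuous_rational_seq[of t "\<lambda>t. N t \<omega>"] cl(1) t unfolding cadlag_def by metis
      have "N (r n) \<omega> \<in> range real" for n
        using elim(1) r(1,2)[of n] t by auto
      then have "0 \<le> N (r n) \<omega>" for n by (metis imageE of_nat_0_le_iff)
      then show ?thesis by (intro LIMSEQ_le_const[OF r(3)]) auto
    qed
    moreover have "L s \<omega> \<le> L t \<omega>" if s: "0 \<le> s" and st: "s \<le> t" for s t
    proof (cases "s = t")
      case False
      then have st: "s < t" using st by simp
      obtain r where r: "\<And>n. r n \<in> \<rat>" "\<And>n. r n > s" "r \<longlonglongrightarrow> s" "(\<lambda>n. L (r n) \<omega>) \<longlonglongrightarrow> L s \<omega>"
        using right_continuous_rational_seq[of s "\<lambda>t. L t \<omega>"] cl(2) s unfolding cadlag_def by metis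
      obtain q where q: "\<And>n. q n \<in> \<rat>" "\<And>n. q n > t" "(\<lambda>n. L (q n) \<omega>) \<longlonglongrightarrow> L t \<omega>"
        using right_continuous_rational_seq[of t "\<lambda>t. L t \<omega>"] cl(2) s st unfolding cadlag_def
        by (metis order.strict_implies_order order_trans)
      \<comment> \<open>Both sequences decrease to their targets from the right; once
        \<open>r n < t\<close>, also \<open>r n < q n\<close>, and monotonicity at rational times
        applies before passing to the limit.\<close>
      have "eventually (\<lambda>n. r n < t) sequentially"
        using r(3) st by (rule order_tendstoD)
      then have "eventually (\<lambda>n. L (r n) \<omega> \<le> L (q n) \<omega>) sequentially"
      proof eventually_elim
        case (elim n)
        then show ?case using \<open>\<forall>s\<in>\<rat> \<inter> {0..}. \<forall>t\<in>\<rat> \<inter> {s..}. L s \<omega> \<le> L t \<omega>\<close> r(1,2)[of n] q(1,2)[of n] s by force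
      qed
      then show ?thesis using tendsto_le[OF _ q(3) r(4)] by simp
    qed simp
    ultimately show ?case using elim(3) cl by (simp add: regular_path_def zero_prod_def)
  qed
qed

end

section \<open>Stieltjes integrals as limits of Riemann sums\<close>

text \<open>The integrand is sampled at left endpoints, so that refinement produces the left limit
  of \<open>n\<close> rather than its value.\<close>

definition riemann_sum :: "real \<Rightarrow> (real \<Rightarrow> real) \<Rightarrow> (real \<Rightarrow> real) \<Rightarrow> real \<Rightarrow> nat \<Rightarrow> real" where
  "riemann_sum c n l h m = (\<Sum>i<m. c powr (- n (real i * h)) * (l (real (Suc i) * h) - l (real i * h)))"

text \<open>A deterministic setting: \<open>n\<close> and \<open>l\<close> stand for one regular
  path of \<open>N\<close> and of \<open>L\<close>.\<close>

context
  fixes c :: real and n l :: "real \<Rightarrow> real"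
  assumes c: "c > 1"
    and n: "cadlag n" "\<And>t. 0 \<le> t \<Longrightarrow> 0 \<le> n t"
    and l: "cadlag l" "\<And>s t. 0 \<le> s \<Longrightarrow> s \<le> t \<Longrightarrow> l s \<le> l t"
begin

abbreviation (input) "integrator \<equiv> \<lambda>s. l (max 0 s)"
abbreviation (input) "integrand \<equiv> \<lambda>s. c powr (- Lim (at_left s) n)"

lemma integrator_mono: "x \<le> y \<Longrightarrow> integrator x \<le> integrator y"
  using l(2) by simp

lemma integrator_right_cont: "continuous (at_right a) integrator"
proof (cases "a < 0")
  case True
  have "eventually (\<lambda>s. integrator s = l 0) (at_right a)"
    using eventually_at_right_less[of a] eventually_at_right_real[OF True]
    by eventually_elim (use True in auto)
  then have "(integrator \<longlongrightarrow> l 0) (at_right a)" by (rule tendsto_eventually)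
  then show ?thesis using True by (simp add: continuous_within)
next
  case False
  then have "continuous (at_right a) l" using l(1) by (simp add: cadlag_def)
  then have "(l \<longlongrightarrow> l a) (at_right a)" by (simp add: continuous_within)
  moreover have "eventually (\<lambda>s. l s = integrator s) (at_right a)"
    using eventually_at_right_less[of a] by eventually_elim (use False in auto)
  ultimately have "(integrator \<longlongrightarrow> l a) (at_right a)" by (rule Lim_transform_eventually)
  then show ?thesis using False by (simp add: continuous_within)
qed

lemma measure_integrator:
  assumes "0 \<le> a" "a \<le> b"
  shows "emeasure (interval_measure integrator) {a<..b} = ennreal (l b - l a)" "measure (interval_measure integrator) {a<..b} = l b - l a"
proof -
  show "emeasure (interval_measure integrator) {a<..b} = ennreal (l b - l a)"
    using emeasure_interval_measure_Ioc[OF assms(2), of integrator] integrator_mono integrator_right_cont assms by simp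
  then show "measure (interval_measure integrator) {a<..b} = l b - l a"
    using l(2)[OF assms] by (simp add: measure_def)
qed

lemma integral_step:
  assumes "0 \<le> a" "a \<le> b"
  shows "integrable (interval_measure integrator) (\<lambda>s. y * indicator {a<..b} s)"
    "(\<integral>s. y * indicator {a<..b} s \<partial>interval_measure integrator) = y * (l b - l a)"
  using measure_integrator[OF assms] by auto

text \<open>The step function whose integral is the Riemann sum of mesh \<open>1 / Suc j\<close>.
  With an integer horizon \<open>T\<close> the grid ends exactly at \<open>T\<close>, after
  \<open>T * Suc j\<close> cells.\<close>

definition step_approx :: "nat \<Rightarrow> nat \<Rightarrow> real \<Rightarrow> real" where
  "step_approx T j s = (\<Sum>i<T * Suc j. c powr (- n (real i / real (Suc j))) * indicator {real i / real (Suc j)<..real (Suc i) / real (Suc j)} s)"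

lemma integral_step_sum:
  "integrable (interval_measure integrator) (step_approx T j)"
  "(\<integral>s. step_approx T j s \<partial>interval_measure integrator) = riemann_sum c n l (1 / real (Suc j)) (T * Suc j)"
proof -
  have le: "real i / real (Suc j) \<le> real (Suc i) / real (Suc j)" for i by (intro divide_right_mono) auto
  note * = integral_step[OF _ le]
  show "integrable (interval_measure integrator) (step_approx T j)"
    unfolding step_approx_def by (intro Bochner_Integration.integrable_sum * ) auto
  show "(\<integral>s. step_approx T j s \<partial>interval_measure integrator) = riemann_sum c n l (1 / real (Suc j)) (T * Suc j)"
    unfolding step_approx_def riemann_sum_def
    by (subst Bochner_Integration.integral_sum, intro *, simp, intro sum.cong refl) (subst *, auto)
qed

text \<open>Cells are open on the left and closed on the right, so the one containing
  \<open>s\<close> has index \<open>\<lceil>s * real (Suc j)\<rceil> - 1\<close>, also when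
  \<open>s\<close> is a grid point.\<close>

lemma step_eq:
  assumes "0 < s" "s \<le> real T"
  shows "step_approx T j s = c powr (- n ((of_int \<lceil>s * real (Suc j)\<rceil> - 1) / real (Suc j)))"
proof -
  define i0 where "i0 = nat (\<lceil>s * real (Suc j)\<rceil> - 1)"
  have pos: "0 < s * real (Suc j)" using assms by simp
  then have cp: "1 \<le> \<lceil>s * real (Suc j)\<rceil>" by (simp add: one_le_ceiling)
  have "s * real (Suc j) \<le> real (T * Suc j)" unfolding of_nat_mult using assms by (intro mult_right_mono) auto
  then have "\<lceil>s * real (Suc j)\<rceil> \<le> int (T * Suc j)" by (simp only: ceiling_le_iff of_int_of_nat_eq)
  then have i0: "i0 < T * Suc j" unfolding i0_def using cp by linarith
  have ri0: "real i0 = of_int \<lceil>s * real (Suc j)\<rceil> - 1"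
    unfolding i0_def using cp by (simp del: of_nat_Suc)
  have "indicator {real i / real (Suc j)<..real (Suc i) / real (Suc j)} s = (if i = i0 then 1 else 0 :: real)" for i
  proof -
    have "s \<in> {real i / real (Suc j)<..real (Suc i) / real (Suc j)} \<longleftrightarrow> real i < s * real (Suc j) \<and> s * real (Suc j) \<le> real (Suc i)"
      by (simp add: pos_divide_less_eq pos_le_divide_eq del: of_nat_Suc)
    also have "\<dots> \<longleftrightarrow> \<lceil>s * real (Suc j)\<rceil> = int i + 1"
      by (simp add: ceiling_eq_iff del: of_nat_Suc) (simp add: add.commute)
    also have "\<dots> \<longleftrightarrow> i = i0" unfolding i0_def using cp by linarith
    finally show ?thesis by (simp add: indicator_def)
  qed
  then have "step_approx T j s = (\<Sum>i<T * Suc j. if i = i0 then c powr (- n (real i / real (Suc j))) else 0)"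
    unfolding step_approx_def by (intro sum.cong) auto
  also have "\<dots> = c powr (- n (real i0 / real (Suc j)))" using i0 by simp
  finally show ?thesis by (simp add: ri0)
qed

lemma step_eq_0:
  assumes "\<not> (0 < s \<and> s \<le> real T)"
  shows "step_approx T j s = 0"
  unfolding step_approx_def
proof (intro sum.neutral ballI)
  fix i assume i: "i \<in> {..<T * Suc j}"
  have "real (Suc i) \<le> real (T * Suc j)" using i by (simp only: of_nat_le_iff) auto
  then have "real (Suc i) / real (Suc j) \<le> real T" unfolding of_nat_mult by (simp add: pos_divide_le_eq del: of_nat_Suc)
  moreover have "0 \<le> real i / real (Suc j)" by simp
  ultimately have "s \<notin> {real i / real (Suc j)<..real (Suc i) / real (Suc j)}" using assms by (meson greaterThanAtMost_iff le_less_trans order_trans)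
  then show "c powr (- n (real i / real (Suc j))) * indicator {real i / real (Suc j)<..real (Suc i) / real (Suc j)} s = 0" by simp
qed

lemma step_bounds: "norm (step_approx T j s) \<le> indicator {0<..real T} s"
proof (cases "0 < s \<and> s \<le> real T")
  case True
  then have "0 < s * real (Suc j)" by simp
  then have "1 \<le> \<lceil>s * real (Suc j)\<rceil>" by (simp add: one_le_ceiling)
  then have "0 \<le> n ((of_int \<lceil>s * real (Suc j)\<rceil> - 1) / real (Suc j))" by (intro n(2)) auto
  then show ?thesis using True c powr_mono[of "- n ((of_int \<lceil>s * real (Suc j)\<rceil> - 1) / real (Suc j))" 0 c]
    by (simp add: step_eq)
next
  case False
  then show ?thesis using step_eq_0[OF False] by simp
qed

text \<open>The left endpoint \<open>\<tau> j\<close> of the cell around \<open>s\<close> lies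
  strictly below \<open>s\<close> and within one mesh of it. It therefore tends to \<open>s\<close>
  from the left, and \<open>n (\<tau> j)\<close> tends to the left limit of \<open>n\<close> at
  \<open>s\<close>.\<close>

lemma step_tendsto: "(\<lambda>j. step_approx T j s) \<longlonglongrightarrow> indicator {0<..real T} s * integrand s"
proof (cases "0 < s \<and> s \<le> real T")
  case True
  define \<tau> where "\<tau> j = (of_int \<lceil>s * real (Suc j)\<rceil> - 1) / real (Suc j)" for j
  have up: "\<tau> j < s" for j
    unfolding \<tau>_def by (subst pos_divide_less_eq) (simp, linarith)
  have lo: "s - inverse (real (Suc j)) \<le> \<tau> j" for j
  proof -
    have "s - inverse (real (Suc j)) = (s * real (Suc j) - 1) / real (Suc j)" by (simp add: field_simps del: of_nat_Suc)
    also have "\<dots> \<le> \<tau> j" unfolding \<tau>_def by (intro divide_right_mono) auto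
    finally show ?thesis .
  qed
  have "\<tau> \<longlonglongrightarrow> s"
  proof (rule tendsto_sandwich[OF _ _ _ tendsto_const])
    show "(\<lambda>j. s - inverse (real (Suc j))) \<longlonglongrightarrow> s"
      using tendsto_diff[OF tendsto_const[of s] LIMSEQ_inverse_real_of_nat] by simp
  qed (use lo up in \<open>auto intro!: always_eventually less_imp_le simp del: of_nat_Suc\<close>)
  then have \<tau>: "filterlim \<tau> (at_left s) sequentially"
    using up by (auto simp: filterlim_at intro!: always_eventually)
  obtain y where y: "(n \<longlongrightarrow> y) (at_left s)" using n(1) True by (auto simp: cadlag_def)
  then have "Lim (at_left s) n = y" by (intro tendsto_Lim) auto
  moreover have "(\<lambda>j. c powr (- n (\<tau> j))) \<longlonglongrightarrow> c powr (- y)"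
    using c by (intro tendsto_powr tendsto_const tendsto_minus filterlim_compose[OF y \<tau>]) auto
  ultimately show ?thesis using True by (simp add: step_eq \<tau>_def)
next
  case False
  then show ?thesis using step_eq_0[OF False] by simp
qed

lemma step_measurable [measurable]: "step_approx T j \<in> borel_measurable (interval_measure integrator)"
  using integral_step_sum(1) by (rule borel_measurable_integrable)

text \<open>Dominated convergence: as \<open>n\<close> is nonnegative and \<open>c > 1\<close>, the
  step functions are bounded by the indicator of the interval, which has finite mass. Measurability
  of the integrand also comes from the approximation.\<close>

lemma
  shows riemann_sum_tendsto:
      "(\<lambda>j. riemann_sum c n l (1 / real (Suc j)) (T * Suc j)) \<longlonglongrightarrow> (LINT s:{0<..real T}|interval_measure integrator. integrand s)"
    and set_integrable_nat: "set_integrable (interval_measure integrator) {0<..real T} integrand"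
proof -
  have m: "(\<lambda>s. indicator {0<..real T} s * integrand s) \<in> borel_measurable (interval_measure integrator)"
    by (rule borel_measurable_LIMSEQ_real[OF step_tendsto[of T] step_measurable])
  have w: "integrable (interval_measure integrator) (\<lambda>s. indicator {0<..real T} s :: real)"
    using integral_step(1)[of 0 "real T" 1] by simp
  have "integrable (interval_measure integrator) (\<lambda>s. indicator {0<..real T} s * integrand s)"
    by (rule integrable_dominated_convergence[where s="step_approx T", OF m step_measurable w]) (auto simp: step_tendsto step_bounds[simplified])
  then show "set_integrable (interval_measure integrator) {0<..real T} integrand"
    by (simp add: set_integrable_def)
  have "(\<lambda>j. \<integral>s. step_approx T j s \<partial>interval_measure integrator) \<longlonglongrightarrow> (\<integral>s. indicator {0<..real T} s * integrand s \<partial>interval_measure integrator)"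
    by (rule integral_dominated_convergence[where s="step_approx T", OF m step_measurable w]) (auto simp: step_tendsto step_bounds[simplified])
  then show "(\<lambda>j. riemann_sum c n l (1 / real (Suc j)) (T * Suc j)) \<longlonglongrightarrow> (LINT s:{0<..real T}|interval_measure integrator. integrand s)"
    by (simp add: integral_step_sum(2) set_lebesgue_integral_def)
qed

section \<open>Dependence on the upper limit of integration\<close>

lemma stieltjes_mono:
  assumes "s \<le> t"
  shows "(LINT x:{0<..s}|interval_measure integrator. integrand x) \<le> (LINT x:{0<..t}|interval_measure integrator. integrand x)"
proof -
  have i: "set_integrable (interval_measure integrator) {0<..t} integrand" for t
    by (rule set_integrable_subset[OF set_integrable_nat[of "nat \<lceil>t\<rceil>"]]) (auto intro: order_trans[OF _ le_of_int_ceiling])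
  show ?thesis
    unfolding set_lebesgue_integral_def using i assms
    by (intro integral_mono) (auto simp: set_integrable_def indicator_def)
qed

text \<open>The integrand is nonnegative, so the integral increases with its upper limit and
  convergence along the integers is enough.\<close>

lemma stieltjes_tendsto_at_top:
  assumes "(\<lambda>T::nat. LINT x:{0<..real T}|interval_measure integrator. integrand x) \<longlonglongrightarrow> y"
  shows "((\<lambda>t. LINT x:{0<..t}|interval_measure integrator. integrand x) \<longlongrightarrow> y) at_top"
proof -
  let ?J = "\<lambda>t. LINT x:{0<..t}|interval_measure integrator. integrand x"
  have le: "?J t \<le> y" for t
  proof -
    have "?J t \<le> ?J (real (nat \<lceil>t\<rceil>))" by (intro stieltjes_mono real_nat_ceiling_ge)
    also have "\<dots> \<le> y"
      using assms by (intro incseq_le[of "\<lambda>T. ?J (real T)"]) (auto simp: incseq_def intro!: stieltjes_mono)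
    finally show ?thesis .
  qed
  show ?thesis
  proof (rule order_tendstoI)
    fix a assume "a < y"
    with assms have "eventually (\<lambda>T. a < ?J (real T)) sequentially" by (rule order_tendstoD(1))
    then obtain T where T: "a < ?J (real T)" by (auto simp: eventually_sequentially)
    show "eventually (\<lambda>t. a < ?J t) at_top"
      using eventually_ge_at_top[of "real T"] by eventually_elim (rule less_le_trans[OF T stieltjes_mono])
  next
    fix a assume "y < a"
    then show "eventually (\<lambda>t. ?J t < a) at_top" using le by (intro always_eventually allI) (meson le_less_trans)
  qed
qed

end

section \<open>The discretised integral\<close>

context gou_process
begin

definition increment :: "real \<Rightarrow> nat \<Rightarrow> 'a \<Rightarrow> real \<times> real" where
  "increment h i \<omega> = (N (real (Suc i) * h) \<omega> - N (real i * h) \<omega>, L (real (Suc i) * h) \<omega> - L (real i * h) \<omega>)"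

lemma indep_increments:
  assumes "0 < h"
  shows "indep_vars (\<lambda>_. borel \<Otimes>\<^sub>M borel) (increment h) {..<m}"
proof -
  have "0 \<le> real 0 * h \<and> (\<forall>i<m. real i * h < real (Suc i) * h)"
    using assms by (auto intro!: mult_strict_right_mono)
  moreover have "\<forall>n ts. 0 \<le> ts 0 \<and> (\<forall>i<n. ts i < ts (Suc i)) \<longrightarrow> indep_vars (\<lambda>_. borel)
     (\<lambda>i \<omega>. (N (ts (Suc i)) \<omega>, L (ts (Suc i)) \<omega>) - (N (ts i) \<omega>, L (ts i) \<omega>)) {..<n}"
    using levy unfolding levy_process_def by (elim conjE)
  ultimately have "indep_vars (\<lambda>_. borel)
     (\<lambda>i \<omega>. (N (real (Suc i) * h) \<omega>, L (real (Suc i) * h) \<omega>) - (N (real i * h) \<omega>, L (real i * h) \<omega>)) {..<m}"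
    by (elim allE[of _ m] allE[of _ "\<lambda>i. real i * h"] mp)
  then show ?thesis
    by (simp add: increment_def[abs_def] borel_prod)
qed

lemma distr_increment_grid:
  assumes "0 < h"
  shows "distr M (borel \<Otimes>\<^sub>M borel) (increment h i) = distr M (borel \<Otimes>\<^sub>M borel) (\<lambda>\<omega>. (N h \<omega>, L h \<omega>))"
  using distr_increment[of "real i * h" h] assms
  by (simp add: increment_def[abs_def] borel_prod distrib_right add.commute)

text \<open>A sum of increments, not a value of \<open>N\<close>: this makes the state after
  \<open>m\<close> steps visibly a function of the first \<open>m\<close> increments, as the
  independence argument requires.\<close>

definition log_discount :: "real \<Rightarrow> nat \<Rightarrow> 'a \<Rightarrow> real" where
  "log_discount h m \<omega> = (\<Sum>j<m. fst (increment h j \<omega>))"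

definition partial_integral :: "real \<Rightarrow> nat \<Rightarrow> 'a \<Rightarrow> real" where
  "partial_integral h m \<omega> = (\<Sum>i<m. c powr (- log_discount h i \<omega>) * snd (increment h i \<omega>))"

lemma log_discount_eq: "log_discount h m \<omega> = N (real m * h) \<omega> - N 0 \<omega>"
  using sum_lessThan_telescope[of "\<lambda>i. N (real i * h) \<omega>" m] by (simp add: log_discount_def increment_def)

lemma partial_integral_eq_riemann_sum:
  "regular_path \<omega> \<Longrightarrow> partial_integral h m \<omega> = riemann_sum c (\<lambda>t. N t \<omega>) (\<lambda>t. L t \<omega>) h m"
  by (simp add: partial_integral_def riemann_sum_def log_discount_eq regular_path_def increment_def)

lemma measurable_grid [measurable]:
  assumes "0 < h"
  shows "increment h i \<in> measurable M (borel \<Otimes>\<^sub>M borel)"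
    and "log_discount h m \<in> borel_measurable M" and "partial_integral h m \<in> borel_measurable M"
proof -
  have [measurable]: "N (real i * h) \<in> borel_measurable M" "L (real i * h) \<in> borel_measurable M" for i
    using assms by (auto intro!: measurable_process)
  show 1[measurable]: "increment h i \<in> measurable M (borel \<Otimes>\<^sub>M borel)" for i
    unfolding increment_def[abs_def] by measurable
  show [measurable]: "log_discount h m \<in> borel_measurable M" for m
    unfolding log_discount_def[abs_def] by measurable
  show "partial_integral h m \<in> borel_measurable M"
    unfolding partial_integral_def[abs_def] by measurable
qed

text \<open>The state after \<open>m\<close> steps is the function \<open>st\<close> of increments
  \<open>0, ..., m - 1\<close>, hence independent of increment \<open>m\<close>; the latter has the
  law of \<open>(N h, L h)\<close> by stationarity.\<close>

lemma distr_state_increment: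
  assumes h: "0 < h"
  shows "distr M ((borel \<Otimes>\<^sub>M borel) \<Otimes>\<^sub>M (borel \<Otimes>\<^sub>M borel))
      (\<lambda>\<omega>. ((partial_integral h m \<omega>, log_discount h m \<omega>), increment h m \<omega>)) =
    distr M (borel \<Otimes>\<^sub>M borel) (\<lambda>\<omega>. (partial_integral h m \<omega>, log_discount h m \<omega>)) \<Otimes>\<^sub>M
    distr M (borel \<Otimes>\<^sub>M borel) (\<lambda>\<omega>. (N h \<omega>, L h \<omega>))"
proof -
  let ?B = "borel \<Otimes>\<^sub>M borel :: (real \<times> real) measure"
  define st where "st x = ((\<Sum>i<m. c powr (- (\<Sum>j<i. fst (x j))) * snd (x i)), \<Sum>j<m. fst (x j))" for x :: "nat \<Rightarrow> real \<times> real"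
  have [measurable]: "(\<lambda>x. x j) \<in> measurable (PiM {..<m} (\<lambda>_. ?B)) ?B" if "j < m" for j
    using that by (intro measurable_component_singleton) auto
  have [measurable]: "(\<lambda>x. \<Sum>j<i. fst (x j)) \<in> borel_measurable (PiM {..<m} (\<lambda>_. ?B))" if "i \<le> m" for i
    using that by (intro borel_measurable_sum) simp
  have [measurable]: "(\<lambda>x. \<Sum>i<m. c powr (- (\<Sum>j<i. fst (x j))) * snd (x i)) \<in> borel_measurable (PiM {..<m} (\<lambda>_. ?B))"
    by (intro borel_measurable_sum) simp
  have st: "st \<in> measurable (PiM {..<m} (\<lambda>_. ?B)) ?B"
    unfolding st_def[abs_def] by simp
  have "indep_var (PiM {..<m} (\<lambda>_. ?B)) (\<lambda>\<omega>. restrict (\<lambda>i. increment h i \<omega>) {..<m})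
       (PiM {m} (\<lambda>_. ?B)) (\<lambda>\<omega>. restrict (\<lambda>i. increment h i \<omega>) {m})"
    by (rule indep_var_restrict[OF indep_increments[OF h, of "Suc m"]]) auto
  then have "indep_var ?B (st \<circ> (\<lambda>\<omega>. restrict (\<lambda>i. increment h i \<omega>) {..<m}))
       ?B ((\<lambda>x. x m) \<circ> (\<lambda>\<omega>. restrict (\<lambda>i. increment h i \<omega>) {m}))"
    by (rule indep_var_compose) (use st in \<open>auto intro!: measurable_component_singleton\<close>)
  moreover have "st \<circ> (\<lambda>\<omega>. restrict (\<lambda>i. increment h i \<omega>) {..<m}) = (\<lambda>\<omega>. (partial_integral h m \<omega>, log_discount h m \<omega>))"
    by (auto simp: st_def partial_integral_def log_discount_def intro!: ext sum.cong)
  moreover have "(\<lambda>x. x m) \<circ> (\<lambda>\<omega>. restrict (\<lambda>i. increment h i \<omega>) {m}) = increment h m"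
    by auto
  ultimately have "indep_var ?B (\<lambda>\<omega>. (partial_integral h m \<omega>, log_discount h m \<omega>)) ?B (increment h m)"
    by simp
  then show ?thesis
    unfolding indep_var_distribution_eq distr_increment_grid[OF h] by simp
qed

text \<open>By Fubini on the product law, the increment that follows the state may be replaced by an
  independent copy of \<open>(N h, L h)\<close> and averaged first.\<close>

lemma markov_integral:
  fixes f :: "(real \<times> real) \<times> (real \<times> real) \<Rightarrow> complex"
  assumes h: "0 < h" and f[measurable]: "f \<in> borel_measurable ((borel \<Otimes>\<^sub>M borel) \<Otimes>\<^sub>M (borel \<Otimes>\<^sub>M borel))"
    and bound: "\<And>x. norm (f x) \<le> B"
  shows "(\<integral>\<omega>. f ((partial_integral h m \<omega>, log_discount h m \<omega>), increment h m \<omega>) \<partial>M) =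
    (\<integral>\<omega>. \<integral>\<omega>'. f ((partial_integral h m \<omega>, log_discount h m \<omega>), (N h \<omega>', L h \<omega>')) \<partial>M \<partial>M)"
proof -
  let ?B = "borel \<Otimes>\<^sub>M borel :: (real \<times> real) measure"
  let ?U = "distr M ?B (\<lambda>\<omega>. (partial_integral h m \<omega>, log_discount h m \<omega>))" and ?V = "distr M ?B (\<lambda>\<omega>. (N h \<omega>, L h \<omega>))"
  note [measurable] = measurable_grid[OF h] measurable_process(2,3)[OF less_imp_le[OF h]]
  interpret U: prob_space ?U by (rule prob_space_distr) simp
  interpret V: prob_space ?V by (rule prob_space_distr) simp
  interpret UV: pair_prob_space ?U ?V ..
  have int: "integrable (?U \<Otimes>\<^sub>M ?V) f"
    by (rule UV.integrable_const_bound[where B=B]) (auto simp: bound)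
  have "(\<integral>\<omega>. f ((partial_integral h m \<omega>, log_discount h m \<omega>), increment h m \<omega>) \<partial>M) =
     (\<integral>x. f x \<partial>distr M (?B \<Otimes>\<^sub>M ?B) (\<lambda>\<omega>. ((partial_integral h m \<omega>, log_discount h m \<omega>), increment h m \<omega>)))"
    by (subst integral_distr) auto
  also have "\<dots> = (\<integral>x. f x \<partial>(?U \<Otimes>\<^sub>M ?V))" by (simp only: distr_state_increment[OF h])
  also have "\<dots> = (\<integral>x. \<integral>y. f (x, y) \<partial>?V \<partial>?U)" using int by (rule UV.integral_fst'[symmetric])
  also have "\<dots> = (\<integral>x. \<integral>\<omega>'. f (x, (N h \<omega>', L h \<omega>')) \<partial>M \<partial>?U)"
    by (intro Bochner_Integration.integral_cong refl integral_distr) auto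
  also have "\<dots> = (\<integral>\<omega>. \<integral>\<omega>'. f ((partial_integral h m \<omega>, log_discount h m \<omega>), (N h \<omega>', L h \<omega>')) \<partial>M \<partial>M)"
    by (intro integral_distr) auto
  finally show ?thesis .
qed

lemma markov_nn_integral:
  assumes h: "0 < h" and f[measurable]: "f \<in> borel_measurable ((borel \<Otimes>\<^sub>M borel) \<Otimes>\<^sub>M (borel \<Otimes>\<^sub>M borel))"
  shows "(\<integral>\<^sup>+\<omega>. f ((partial_integral h m \<omega>, log_discount h m \<omega>), increment h m \<omega>) \<partial>M) =
    (\<integral>\<^sup>+\<omega>. \<integral>\<^sup>+\<omega>'. f ((partial_integral h m \<omega>, log_discount h m \<omega>), (N h \<omega>', L h \<omega>')) \<partial>M \<partial>M)"
proof -
  let ?B = "borel \<Otimes>\<^sub>M borel :: (real \<times> real) measure"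
  let ?U = "distr M ?B (\<lambda>\<omega>. (partial_integral h m \<omega>, log_discount h m \<omega>))" and ?V = "distr M ?B (\<lambda>\<omega>. (N h \<omega>, L h \<omega>))"
  note [measurable] = measurable_grid[OF h] measurable_process(2,3)[OF less_imp_le[OF h]]
  interpret U: prob_space ?U by (rule prob_space_distr) simp
  interpret V: prob_space ?V by (rule prob_space_distr) simp
  have "(\<integral>\<^sup>+\<omega>. f ((partial_integral h m \<omega>, log_discount h m \<omega>), increment h m \<omega>) \<partial>M) =
     (\<integral>\<^sup>+x. f x \<partial>distr M (?B \<Otimes>\<^sub>M ?B) (\<lambda>\<omega>. ((partial_integral h m \<omega>, log_discount h m \<omega>), increment h m \<omega>)))"
    by (subst nn_integral_distr) auto
  also have "\<dots> = (\<integral>\<^sup>+x. f x \<partial>(?U \<Otimes>\<^sub>M ?V))" by (simp only: distr_state_increment[OF h])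
  also have "\<dots> = (\<integral>\<^sup>+x. \<integral>\<^sup>+y. f (x, y) \<partial>?V \<partial>?U)" by (rule V.nn_integral_fst[symmetric]) simp
  also have "\<dots> = (\<integral>\<^sup>+x. \<integral>\<^sup>+\<omega>'. f (x, (N h \<omega>', L h \<omega>')) \<partial>M \<partial>?U)"
    by (intro nn_integral_cong refl nn_integral_distr) auto
  also have "\<dots> = (\<integral>\<^sup>+\<omega>. \<integral>\<^sup>+\<omega>'. f ((partial_integral h m \<omega>, log_discount h m \<omega>), (N h \<omega>', L h \<omega>')) \<partial>M \<partial>M)"
    by (intro nn_integral_distr) auto
  finally show ?thesis .
qed

text \<open>If \<open>g\<close> is the characteristic function of \<open>Z\<close>, this is the
  characteristic function of \<open>L h + c powr (- N h) * Z\<close> with \<open>Z\<close>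
  independent of \<open>(N h, L h)\<close>: one step of the perpetuity.\<close>

definition transition :: "real \<Rightarrow> (real \<Rightarrow> complex) \<Rightarrow> real \<Rightarrow> complex" where
  "transition h g y = (\<integral>\<omega>. iexp (y * L h \<omega>) * g (c powr (- N h \<omega>) * y) \<partial>M)"

lemma transition_props:
  assumes h: "0 < h" and g[measurable]: "g \<in> borel_measurable borel" and bound: "\<And>x. norm (g x) \<le> 1"
  shows "transition h g \<in> borel_measurable borel" "norm (transition h g y) \<le> 1"
proof -
  note [measurable] = measurable_process(2,3)[OF less_imp_le[OF h]]
  show "transition h g \<in> borel_measurable borel"
    unfolding transition_def[abs_def] by measurable
  have "norm (transition h g y) \<le> (\<integral>\<omega>. norm (iexp (y * L h \<omega>) * g (c powr (- N h \<omega>) * y)) \<partial>M)"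
    unfolding transition_def by (rule integral_norm_bound)
  also have "\<dots> \<le> (\<integral>\<omega>. 1 \<partial>M)"
    by (rule integral_mono') (auto simp: norm_mult bound simp del: of_real_mult)
  finally have "norm (transition h g y) \<le> (\<integral>\<omega>. 1 \<partial>M)" .
  then show "norm (transition h g y) \<le> 1" by (simp add: prob_space)
qed

text \<open>A general test function \<open>g\<close> is carried so that the induction closes:
  averaging over the last increment turns \<open>g\<close> into
  \<open>transition h g\<close>.\<close>

lemma transition_iterate:
  assumes h: "0 < h" and "g \<in> borel_measurable borel" "\<And>x. norm (g x) \<le> 1"
  shows "(\<integral>\<omega>. iexp (z * partial_integral h m \<omega>) * g (c powr (- log_discount h m \<omega>) * z) \<partial>M) = (transition h ^^ m) g z"
  using assms(2,3)
proof (induction m arbitrary: g)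
  case 0
  then show ?case using c by (simp add: partial_integral_def log_discount_def prob_space)
next
  case (Suc m)
  note [measurable] = Suc.prems(1)
  let ?f = "\<lambda>x :: (real \<times> real) \<times> real \<times> real. iexp (z * fst (fst x)) *
    (iexp (c powr (- snd (fst x)) * z * snd (snd x)) * g (c powr (- fst (snd x)) * (c powr (- snd (fst x)) * z)))"
  have "(\<integral>\<omega>. iexp (z * partial_integral h (Suc m) \<omega>) * g (c powr (- log_discount h (Suc m) \<omega>) * z) \<partial>M)
     = (\<integral>\<omega>. ?f ((partial_integral h m \<omega>, log_discount h m \<omega>), increment h m \<omega>) \<partial>M)"
    by (intro Bochner_Integration.integral_cong refl)
       (simp add: partial_integral_def log_discount_def case_prod_beta distrib_left exp_add powr_diff powr_minus divide_inverse mult_ac)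
  also have "\<dots> = (\<integral>\<omega>. \<integral>\<omega>'. ?f ((partial_integral h m \<omega>, log_discount h m \<omega>), (N h \<omega>', L h \<omega>')) \<partial>M \<partial>M)"
    by (rule markov_integral[OF h, of _ 1]) (auto simp: norm_mult Suc.prems(2) case_prod_beta simp del: of_real_mult)
  also have "\<dots> = (\<integral>\<omega>. iexp (z * partial_integral h m \<omega>) * transition h g (c powr (- log_discount h m \<omega>) * z) \<partial>M)"
    by (simp add: transition_def)
  also have "\<dots> = (transition h ^^ m) (transition h g) z"
    by (rule Suc.IH) (use transition_props[OF h Suc.prems] in auto)
  finally show ?case by (simp add: funpow_swap1)
qed

definition grid_char :: "real \<Rightarrow> nat \<Rightarrow> real \<Rightarrow> complex" where
  "grid_char h m z = (\<integral>\<omega>. iexp (z * partial_integral h m \<omega>) \<partial>M)"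

text \<open>Summands are appended at the end of the sum, whereas this recursion splits off the first
  increment. Both views agree because the \<open>m\<close>-step function is the \<open>m\<close>-th
  iterate of \<open>transition h\<close> on the constant 1.\<close>

lemma grid_char_Suc:
  assumes "0 < h"
  shows "grid_char h (Suc m) z = transition h (grid_char h m) z"
  using transition_iterate[OF assms, of "\<lambda>_. 1"] by (simp add: grid_char_def[abs_def])

lemma grid_char_props:
  assumes "0 < h"
  shows "grid_char h m \<in> borel_measurable borel" "norm (grid_char h m z) \<le> 1"
proof -
  have "grid_char h m \<in> borel_measurable borel \<and> (\<forall>z. norm (grid_char h m z) \<le> 1)"
  proof (induction m)
    case 0
    then show ?case by (simp add: grid_char_def[abs_def] partial_integral_def prob_space)
  next
    case (Suc m)
    then show ?case using transition_props[OF assms, of "grid_char h m"] grid_char_Suc[OF assms, of m]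
      by (metis (no_types, lifting) ext)
  qed
  then show "grid_char h m \<in> borel_measurable borel" "norm (grid_char h m z) \<le> 1" by auto
qed

section \<open>Mean bounds for the discretised integral\<close>

lemma nn_integral_summand:
  assumes h: "0 < h"
  shows "(\<integral>\<^sup>+\<omega>. ennreal (c powr (- log_discount h m \<omega>)) * ennreal (snd (increment h m \<omega>)) \<partial>M)
    = ennreal (exp (- decay_rate * (real m * h)) * (h * (v + w * d)))"
proof -
  note [measurable] = measurable_grid[OF h] measurable_process(2,3)[OF less_imp_le[OF h]]
  have mh: "0 \<le> real m * h" using h by simp
  let ?f = "\<lambda>x :: (real \<times> real) \<times> real \<times> real. ennreal (c powr (- snd (fst x))) * ennreal (snd (snd x))"
  have "(\<integral>\<^sup>+\<omega>. ennreal (c powr (- log_discount h m \<omega>)) * ennreal (snd (increment h m \<omega>)) \<partial>M)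
      = (\<integral>\<^sup>+\<omega>. ?f ((partial_integral h m \<omega>, log_discount h m \<omega>), increment h m \<omega>) \<partial>M)"
    by (simp add: case_prod_beta)
  also have "\<dots> = (\<integral>\<^sup>+\<omega>. \<integral>\<^sup>+\<omega>'. ?f ((partial_integral h m \<omega>, log_discount h m \<omega>), (N h \<omega>', L h \<omega>')) \<partial>M \<partial>M)"
    by (rule markov_nn_integral[OF h]) measurable
  \<comment> \<open>The discount at the start of a cell is independent of the increment over it, so
    the mean factorises.\<close>
  also have "\<dots> = (\<integral>\<^sup>+\<omega>. ennreal (c powr (- log_discount h m \<omega>)) \<partial>M) * ennreal (h * (v + w * d))"
    using h by (simp add: nn_integral_cmult nn_integral_L nn_integral_multc)
  also have "(\<integral>\<^sup>+\<omega>. ennreal (c powr (- log_discount h m \<omega>)) \<partial>M) = (\<integral>\<^sup>+\<omega>. ennreal (c powr (- N (real m * h) \<omega>)) \<partial>M)"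
    using AE_regular_path by (intro nn_integral_cong_AE) (auto simp: log_discount_eq regular_path_def elim!: eventually_mono)
  also have "\<dots> = ennreal (exp (- decay_rate * (real m * h)))"
    using expectation_discount[OF mh] by (subst nn_integral_eq_integral) auto
  finally show ?thesis
    using d_pos v w h by (simp add: ennreal_mult)
qed

text \<open>The means of the summands form a geometric series. The bound is uniform in both
  \<open>m\<close> and \<open>h\<close>, as Fatou's lemma will need when the mesh tends to 0 and
  then the horizon to infinity.\<close>

lemma nn_integral_partial_integral:
  assumes h: "0 < h" "h \<le> 1"
  shows "(\<integral>\<^sup>+\<omega>. ennreal (partial_integral h m \<omega>) \<partial>M) \<le> ennreal ((1 + decay_rate) / decay_rate * (v + w * d))"
proof -
  note [measurable] = measurable_grid[OF h(1)] measurable_process(2,3)[OF less_imp_le[OF h(1)]]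
  let ?l = "v + w * d"
  have l: "0 \<le> ?l" using d_pos v w by simp
  \<comment> \<open>Since \<open>ennreal\<close> truncates negative numbers to 0, it is subadditive
    without any sign condition.\<close>
  have sub: "ennreal (x + y) \<le> ennreal x + ennreal y" for x y
    by (cases "x \<ge> 0"; cases "y \<ge> 0") (auto simp: ennreal_neg simp flip: ennreal_plus intro!: ennreal_leI)
  have "(\<integral>\<^sup>+\<omega>. ennreal (partial_integral h m \<omega>) \<partial>M) \<le> ennreal ((\<Sum>i<m. exp (- decay_rate * h) ^ i) * (h * ?l))"
  proof (induction m)
    case (Suc m)
    have "(\<integral>\<^sup>+\<omega>. ennreal (partial_integral h (Suc m) \<omega>) \<partial>M) \<le>
      (\<integral>\<^sup>+\<omega>. ennreal (partial_integral h m \<omega>) + ennreal (c powr (- log_discount h m \<omega>)) * ennreal (snd (increment h m \<omega>)) \<partial>M)"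
      by (intro nn_integral_mono) (auto simp: partial_integral_def ennreal_mult'[symmetric] intro: sub)
    also have "\<dots> = (\<integral>\<^sup>+\<omega>. ennreal (partial_integral h m \<omega>) \<partial>M) + ennreal (exp (- decay_rate * (real m * h)) * (h * ?l))"
      by (subst nn_integral_add) (auto simp: nn_integral_summand[OF h(1)])
    also have "\<dots> \<le> ennreal ((\<Sum>i<m. exp (- decay_rate * h) ^ i) * (h * ?l)) + ennreal (exp (- decay_rate * (real m * h)) * (h * ?l))"
      by (intro add_right_mono Suc.IH)
    also have "\<dots> = ennreal ((\<Sum>i<m. exp (- decay_rate * h) ^ i) * (h * ?l) + exp (- decay_rate * (real m * h)) * (h * ?l))"
      using l h by (intro ennreal_plus[symmetric]) (auto intro!: mult_nonneg_nonneg sum_nonneg)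
    also have "exp (- decay_rate * (real m * h)) = exp (- decay_rate * h) ^ m"
      by (simp add: exp_of_nat_mult[symmetric] mult_ac)
    finally show ?case by (simp add: distrib_right)
  qed (simp add: partial_integral_def)
  also have "\<dots> \<le> ennreal ((1 + decay_rate) / decay_rate * ?l)"
  proof (rule ennreal_leI)
    have kh: "0 < decay_rate * h" using decay_rate_pos h by simp
    then have e: "0 < 1 - exp (- decay_rate * h)" by simp
    have "(\<Sum>i<m. exp (- decay_rate * h) ^ i) * (1 - exp (- decay_rate * h)) = 1 - exp (- decay_rate * h) ^ m"
      by (metis mult.commute one_diff_power_eq)
    also have "\<dots> \<le> 1" by simp
    finally have 1: "(\<Sum>i<m. exp (- decay_rate * h) ^ i) * (1 - exp (- decay_rate * h)) \<le> 1" .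
    \<comment> \<open>From \<open>1 + x \<le> exp x\<close> it follows that
      \<open>h / (1 - exp (- decay_rate * h))\<close> is at most
      \<open>(1 + decay_rate * h) / decay_rate\<close>, which stays bounded for
      \<open>h \<le> 1\<close>.\<close>
    have "(1 + decay_rate * h) * exp (- decay_rate * h) \<le> exp (decay_rate * h) * exp (- decay_rate * h)"
      by (intro mult_right_mono) auto
    then have "(1 + decay_rate * h) * exp (- decay_rate * h) \<le> 1" by (simp flip: exp_add)
    then have 2: "decay_rate * h \<le> (1 - exp (- decay_rate * h)) * (1 + decay_rate * h)" by (simp add: algebra_simps)
    let ?S = "(\<Sum>i<m. exp (- decay_rate * h) ^ i)"
    have "?S * h * decay_rate = ?S * (decay_rate * h)" by simp
    also have "\<dots> \<le> ?S * ((1 - exp (- decay_rate * h)) * (1 + decay_rate * h))"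
      using 2 by (intro mult_left_mono sum_nonneg) auto
    also have "\<dots> = (?S * (1 - exp (- decay_rate * h))) * (1 + decay_rate * h)" by simp
    also have "\<dots> \<le> 1 * (1 + decay_rate * h)" using 1 kh by (intro mult_right_mono) auto
    also have "\<dots> \<le> 1 + decay_rate" using h decay_rate_pos by (simp add: mult_left_le)
    finally have "?S * h \<le> (1 + decay_rate) / decay_rate" using decay_rate_pos by (simp add: pos_le_divide_eq)
    from mult_right_mono[OF this l] show "?S * (h * ?l) \<le> (1 + decay_rate) / decay_rate * ?l"
      by (simp only: mult.assoc)
  qed
  finally show ?thesis .
qed

text \<open>As \<open>iexp\<close> is 1-Lipschitz, one more step changes the characteristic function
  by at most \<open>\<bar>z\<bar>\<close> times the mean of the new summand. The factor
  \<open>h\<close> survives the later division by \<open>h\<close>, and the exponential vanishes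
  with growing horizon.\<close>

lemma grid_char_Suc_diff:
  assumes h: "0 < h"
  shows "norm (grid_char h (Suc m) z - grid_char h m z) \<le> \<bar>z\<bar> * (exp (- decay_rate * (real m * h)) * (h * (v + w * d)))"
proof -
  note [measurable] = measurable_grid[OF h] measurable_process(2,3)[OF less_imp_le[OF h]]
  have 0: "0 \<le> exp (- decay_rate * (real m * h)) * (h * (v + w * d))" using d_pos v w h by simp
  have iexp_diff: "norm (iexp a - iexp b) \<le> \<bar>a - b\<bar>" for a b
  proof -
    have "norm (iexp a - iexp b) = norm (iexp b * (iexp (a - b) - 1))"
      by (simp add: right_diff_distrib flip: exp_add)
    also have "\<dots> \<le> \<bar>a - b\<bar>"
      using iexp_approx1[of "a - b" 0] by (simp add: norm_mult del: of_real_diff)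
    finally show ?thesis .
  qed
  have i: "integrable M (\<lambda>\<omega>. iexp (z * partial_integral h m \<omega>))" for m
    by (intro integrable_const_bound[where B=1]) (auto simp del: of_real_mult)
  have "AE \<omega> in M. 0 \<le> snd (increment h m \<omega>)"
    using AE_regular_path by eventually_elim (use h in \<open>auto simp: regular_path_def increment_def intro!: mult_right_mono\<close>)
  then have AE: "AE \<omega> in M. ennreal (norm (iexp (z * partial_integral h (Suc m) \<omega>) - iexp (z * partial_integral h m \<omega>)))
     \<le> ennreal \<bar>z\<bar> * (ennreal (c powr (- log_discount h m \<omega>)) * ennreal (snd (increment h m \<omega>)))"
  proof eventually_elim
    case (elim \<omega>)
    have "norm (iexp (z * partial_integral h (Suc m) \<omega>) - iexp (z * partial_integral h m \<omega>))
       \<le> \<bar>z * partial_integral h (Suc m) \<omega> - z * partial_integral h m \<omega>\<bar>" by (rule iexp_diff)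
    also have "\<dots> = \<bar>z\<bar> * (c powr (- log_discount h m \<omega>) * snd (increment h m \<omega>))"
      using elim by (simp add: partial_integral_def distrib_left abs_mult)
    finally show ?case using elim by (simp add: ennreal_mult[symmetric] ennreal_leI)
  qed
  have "grid_char h (Suc m) z - grid_char h m z = (\<integral>\<omega>. iexp (z * partial_integral h (Suc m) \<omega>) - iexp (z * partial_integral h m \<omega>) \<partial>M)"
    unfolding grid_char_def by (intro Bochner_Integration.integral_diff[symmetric] i)
  then have "ennreal (norm (grid_char h (Suc m) z - grid_char h m z)) \<le>
     (\<integral>\<^sup>+\<omega>. ennreal (norm (iexp (z * partial_integral h (Suc m) \<omega>) - iexp (z * partial_integral h m \<omega>))) \<partial>M)"
    by (simp only:) (intro integral_norm_bound_ennreal Bochner_Integration.integrable_diff i)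
  also have "\<dots> \<le> (\<integral>\<^sup>+\<omega>. ennreal \<bar>z\<bar> * (ennreal (c powr (- log_discount h m \<omega>)) * ennreal (snd (increment h m \<omega>))) \<partial>M)"
    by (rule nn_integral_mono_AE[OF AE])
  also have "\<dots> = ennreal (\<bar>z\<bar> * (exp (- decay_rate * (real m * h)) * (h * (v + w * d))))"
    using 0 by (subst nn_integral_cmult) (auto simp: nn_integral_summand[OF h] ennreal_mult[symmetric])
  finally show ?thesis using 0 by (subst (asm) ennreal_le_iff) auto
qed

end

section \<open>The functional equation\<close>

lemma exp_difference_quotient_tendsto:
  fixes a :: complex
  shows "(\<lambda>j. real (Suc j) * (exp ((1 / real (Suc j)) * a) - 1)) \<longlonglongrightarrow> a"
proof -
  have "((\<lambda>h. exp (h * a)) has_field_derivative a) (at 0)"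
    by (auto intro!: derivative_eq_intros)
  then have "((\<lambda>h. (exp (h * a) - 1) / h) \<longlongrightarrow> a) (at 0)"
    by (simp add: DERIV_def)
  moreover have "filterlim (\<lambda>j. complex_of_real (inverse (real (Suc j)))) (at 0) sequentially"
    using tendsto_of_real[OF LIMSEQ_inverse_real_of_nat, where 'a=complex]
    by (auto simp: filterlim_at intro!: always_eventually simp del: of_nat_Suc)
  ultimately have "(\<lambda>j. (exp (complex_of_real (inverse (real (Suc j))) * a) - 1) / complex_of_real (inverse (real (Suc j)))) \<longlonglongrightarrow> a"
    by (rule filterlim_compose)
  then show ?thesis by (simp add: inverse_eq_divide mult.commute)
qed

lemma incseq_convergent_of_liminf:
  fixes X :: "nat \<Rightarrow> real"
  assumes "incseq X" and "liminf (\<lambda>n. ennreal (X n)) \<noteq> \<infinity>"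
  shows "convergent X"
proof -
  have "incseq (\<lambda>n. ennreal (X n))"
    using assms(1) by (auto simp: incseq_def intro: ennreal_leI)
  then have "(\<lambda>n. ennreal (X n)) \<longlonglongrightarrow> (SUP n. ennreal (X n))" by (rule LIMSEQ_SUP)
  then have "liminf (\<lambda>n. ennreal (X n)) = (SUP n. ennreal (X n))" by (intro lim_imp_Liminf) auto
  with assms(2) obtain b where b: "0 \<le> b" "(SUP n. ennreal (X n)) = ennreal b"
    by (cases "SUP n. ennreal (X n)") auto
  then have "ennreal (X n) \<le> ennreal b" for n by (metis SUP_upper UNIV_I)
  then have "X n \<le> b" for n using b(1) by (metis ennreal_le_iff)
  then obtain y where "X \<longlonglongrightarrow> y" using incseq_convergent[OF assms(1)] by blast
  then show ?thesis by (auto simp: convergent_def)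
qed

context gou_process
begin

text \<open>Two or more jumps of \<open>N\<close> in one cell have probability of order
  \<open>h ^ 2\<close>, negligible after division by \<open>h\<close>. The estimate follows from
  \<open>1 - x \<le> exp (- x)\<close>.\<close>

lemma prob_N_ge_2_le:
  assumes "0 \<le> h"
  shows "measure M {\<omega> \<in> space M. 2 \<le> N h \<omega>} \<le> (h * (u + w)) ^ 2"
proof -
  let ?x = "h * (u + w)"
  have x: "0 \<le> ?x" using assms uw by simp
  have "(1 - ?x) * (1 + ?x) \<le> exp (- ?x) * (1 + ?x)"
    using x exp_ge_add_one_self[of "- ?x"] by (intro mult_right_mono) auto
  then show ?thesis
    unfolding prob_N_ge_2[OF assms] by (simp add: power2_eq_square algebra_simps)
qed

text \<open>On the event that \<open>N h\<close> is 0 or 1, the indicators of these two values are \<open>(1 \<plusminus> iexp (\<pi> N)) / 2\<close>; so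
  the joint characteristic function suffices, without identifying the joint law.\<close>

lemma transition_expansion:
  fixes z :: real
  assumes h: "0 < h" and g[measurable]: "g \<in> borel_measurable borel" and bound: "\<And>x. norm (g x) \<le> 1"
  defines "e0 \<equiv> exp (h * jump_exponent 0 z)" and "e1 \<equiv> exp (h * jump_exponent pi z)"
  shows "norm (transition h g z - (g z * ((e0 + e1) / 2) + g (z / c) * ((e0 - e1) / 2))) \<le> 3 * (h * (u + w)) ^ 2"
proof -
  note [measurable] = measurable_process(2,3)[OF less_imp_le[OF h]]
  let ?A = "\<lambda>\<omega>. iexp (0 * N h \<omega> + z * L h \<omega>)" and ?B = "\<lambda>\<omega>. iexp (pi * N h \<omega> + z * L h \<omega>)"
  let ?G = "\<lambda>\<omega>. iexp (z * L h \<omega>) * g (c powr (- N h \<omega>) * z)"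
  have iA: "integrable M ?A" and iB: "integrable M ?B" and iG: "integrable M ?G"
    by (auto intro!: integrable_const_bound[where B=1] simp: norm_mult bound simp del: of_real_mult of_real_add)
  have A: "(\<integral>\<omega>. ?A \<omega> \<partial>M) = e0" and B: "(\<integral>\<omega>. ?B \<omega> \<partial>M) = e1"
    using joint_char[of h 0 z] joint_char[of h pi z] h by (simp_all add: e0_def e1_def)
  let ?D = "\<lambda>\<omega>. ?G \<omega> - (g z * ((?A \<omega> + ?B \<omega>) / 2) + g (z / c) * ((?A \<omega> - ?B \<omega>) / 2))"
  have iD: "integrable M ?D"
    by (intro Bochner_Integration.integrable_diff Bochner_Integration.integrable_add integrable_mult_right integrable_divide iA iB iG)
  have hA: "has_bochner_integral M ?A e0" and hB: "has_bochner_integral M ?B e1"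
    and hG: "has_bochner_integral M ?G (transition h g z)"
    using iA iB iG A B by (simp_all add: has_bochner_integral_iff transition_def)
  have D: "(\<integral>\<omega>. ?D \<omega> \<partial>M) = transition h g z - (g z * ((e0 + e1) / 2) + g (z / c) * ((e0 - e1) / 2))"
    by (rule has_bochner_integral_integral_eq, intro has_bochner_integral_diff has_bochner_integral_add
        has_bochner_integral_mult_right has_bochner_integral_divide hA hB hG)
  \<comment> \<open>The error \<open>?D\<close> vanishes where \<open>N h\<close> is 0 or 1.
    Elsewhere it consists of three terms of modulus at most 1, whence the constant 3.\<close>
  have "AE \<omega> in M. norm (?D \<omega>) \<le> 3 * indicator {\<omega> \<in> space M. 2 \<le> N h \<omega>} \<omega>"
    using AE_N_nat[OF less_imp_le[OF h]] AE_space
  proof eventually_elim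
    case (elim \<omega>)
    then obtain j where j: "N h \<omega> = real j" by auto
    consider "j = 0" | "j = 1" | "2 \<le> j" by linarith
    then show ?case
    proof cases
      case 1
      then show ?thesis using j c by simp
    next
      case 2
      have "?B \<omega> = - ?A \<omega>" using j 2 by (simp add: distrib_left exp_add)
      moreover have "c powr (- N h \<omega>) * z = z / c"
        using j 2 c by (simp add: powr_minus divide_inverse mult.commute)
      ultimately show ?thesis by (simp only:) simp
    next
      case 3
      have "norm (?D \<omega>) \<le> norm (?G \<omega>) + (norm (g z * ((?A \<omega> + ?B \<omega>) / 2)) + norm (g (z / c) * ((?A \<omega> - ?B \<omega>) / 2)))"
        by (intro order_trans[OF norm_triangle_ineq4] add_left_mono norm_triangle_ineq)
      also have "\<dots> \<le> 1 + (1 * 1 + 1 * 1)"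
      proof (intro add_mono)
        show "norm (?G \<omega>) \<le> 1" by (simp add: norm_mult bound del: of_real_mult)
        have "norm (?A \<omega> + ?B \<omega>) \<le> 2" "norm (?A \<omega> - ?B \<omega>) \<le> 2"
          using norm_triangle_ineq[of "?A \<omega>" "?B \<omega>"] norm_triangle_ineq4[of "?A \<omega>" "?B \<omega>"]
          by (simp_all del: of_real_mult of_real_add)
        then show "norm (g z * ((?A \<omega> + ?B \<omega>) / 2)) \<le> 1 * 1" "norm (g (z / c) * ((?A \<omega> - ?B \<omega>) / 2)) \<le> 1 * 1"
          unfolding norm_mult[of "g _"] norm_divide
          by (intro mult_mono bound; simp del: of_real_mult of_real_add)+
      qed
      finally show ?thesis using 3 j elim by (simp add: indicator_def)
    qed
  qed
  then have "norm (\<integral>\<omega>. ?D \<omega> \<partial>M) \<le> (\<integral>\<omega>. 3 * indicator {\<omega> \<in> space M. 2 \<le> N h \<omega>} \<omega> \<partial>M)"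
    by (intro order_trans[OF integral_norm_bound] integral_mono_AE integrable_norm iD)
       (auto intro!: integrable_const_bound[where B=3] simp: indicator_def)
  also have "\<dots> = 3 * measure M {\<omega> \<in> space M. 2 \<le> N h \<omega>}" by simp
  also have "\<dots> \<le> 3 * (h * (u + w)) ^ 2" using prob_N_ge_2_le[of h] h by simp
  finally show ?thesis unfolding D[symmetric] .
qed

section \<open>Convergence of the grid sums and of the improper integral\<close>

definition grid_integral :: "nat \<Rightarrow> nat \<Rightarrow> 'a \<Rightarrow> real" where
  "grid_integral T j = partial_integral (1 / real (Suc j)) (T * Suc j)"

text \<open>A limit of measurable functions, hence measurable on the whole space; it agrees with the
  Stieltjes integral on regular paths.\<close>

definition integral_to :: "nat \<Rightarrow> 'a \<Rightarrow> real" where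
  "integral_to T \<omega> = lim (\<lambda>j. grid_integral T j \<omega>)"

lemma measurable_integral_to [measurable]:
  "grid_integral T j \<in> borel_measurable M" "integral_to T \<in> borel_measurable M"
proof -
  show [measurable]: "grid_integral T j \<in> borel_measurable M" for j
    unfolding grid_integral_def by (rule measurable_grid) simp
  show "integral_to T \<in> borel_measurable M"
    unfolding integral_to_def[abs_def] by measurable
qed

lemma grid_integral_tendsto:
  assumes "regular_path \<omega>"
  shows "(\<lambda>j. grid_integral T j \<omega>) \<longlonglongrightarrow> integral_to T \<omega>" "integral_to T \<omega> = stieltjes_integral c N L (real T) \<omega>"
proof -
  have "(\<lambda>j. grid_integral T j \<omega>) \<longlonglongrightarrow> stieltjes_integral c N L (real T) \<omega>"
    unfolding grid_integral_def partial_integral_eq_riemann_sum[OF assms] stieltjes_integral_def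
    by (rule riemann_sum_tendsto) (use assms c in \<open>auto simp: regular_path_def\<close>)
  then show "(\<lambda>j. grid_integral T j \<omega>) \<longlonglongrightarrow> integral_to T \<omega>" "integral_to T \<omega> = stieltjes_integral c N L (real T) \<omega>"
    by (simp_all add: integral_to_def limI)
qed

text \<open>Fatou's lemma is applied twice to the uniform mean bound, first as the mesh tends to 0
  and then as \<open>T\<close> grows. On regular paths the integral increases with \<open>T\<close>,
  so a finite lower limit gives convergence.\<close>

lemma AE_convergent_integral_to: "AE \<omega> in M. convergent (\<lambda>T. integral_to T \<omega>)"
proof -
  let ?C = "ennreal ((1 + decay_rate) / decay_rate * (v + w * d))"
  have 1: "(\<integral>\<^sup>+\<omega>. ennreal (integral_to T \<omega>) \<partial>M) \<le> ?C" for T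
  proof -
    have "(\<integral>\<^sup>+\<omega>. ennreal (integral_to T \<omega>) \<partial>M) = (\<integral>\<^sup>+\<omega>. liminf (\<lambda>j. ennreal (grid_integral T j \<omega>)) \<partial>M)"
    proof (rule nn_integral_cong_AE)
      show "AE \<omega> in M. ennreal (integral_to T \<omega>) = liminf (\<lambda>j. ennreal (grid_integral T j \<omega>))"
        using AE_regular_path
      proof eventually_elim
        case (elim \<omega>)
        have "(\<lambda>j. ennreal (grid_integral T j \<omega>)) \<longlonglongrightarrow> ennreal (integral_to T \<omega>)"
          by (intro tendsto_ennrealI grid_integral_tendsto elim)
        then show ?case by (intro lim_imp_Liminf[symmetric]) auto
      qed
    qed
    also have "\<dots> \<le> liminf (\<lambda>j. \<integral>\<^sup>+\<omega>. ennreal (grid_integral T j \<omega>) \<partial>M)"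
      by (rule nn_integral_liminf) simp
    also have "\<dots> \<le> liminf (\<lambda>j::nat. ?C)"
      unfolding grid_integral_def
      by (intro Liminf_mono always_eventually allI nn_integral_partial_integral) auto
    finally show ?thesis by (simp add: Liminf_const)
  qed
  have "(\<integral>\<^sup>+\<omega>. liminf (\<lambda>T. ennreal (integral_to T \<omega>)) \<partial>M) \<le> liminf (\<lambda>T. \<integral>\<^sup>+\<omega>. ennreal (integral_to T \<omega>) \<partial>M)"
    by (rule nn_integral_liminf) simp
  also have "\<dots> \<le> liminf (\<lambda>T::nat. ?C)"
    by (intro Liminf_mono always_eventually allI 1)
  finally have "(\<integral>\<^sup>+\<omega>. liminf (\<lambda>T. ennreal (integral_to T \<omega>)) \<partial>M) \<noteq> \<infinity>"
    by (auto simp: Liminf_const top_unique)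
  then have "AE \<omega> in M. liminf (\<lambda>T. ennreal (integral_to T \<omega>)) \<noteq> \<infinity>"
    by (intro nn_integral_noteq_infinite) auto
  with AE_regular_path show ?thesis
  proof eventually_elim
    case (elim \<omega>)
    have "incseq (\<lambda>T. integral_to T \<omega>)"
      unfolding incseq_def grid_integral_tendsto(2)[OF elim(1)] stieltjes_integral_def
      by (intro allI impI stieltjes_mono) (use elim(1) c in \<open>auto simp: regular_path_def\<close>)
    then show ?case using elim(2) by (rule incseq_convergent_of_liminf)
  qed
qed

text \<open>The choice in \<open>improper_integral\<close> is justified by the witness
  \<open>lim (\<lambda>T. integral_to T \<omega>)\<close>, which is measurable and almost surely the
  limit along real times.\<close>

lemma improper_integral_props:
  "improper_integral c M N L \<in> borel_measurable M"
  "AE \<omega> in M. (\<lambda>T. integral_to T \<omega>) \<longlonglongrightarrow> improper_integral c M N L \<omega>"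
proof -
  let ?P = "\<lambda>Y. Y \<in> borel_measurable M \<and> (AE \<omega> in M. ((\<lambda>t. stieltjes_integral c N L t \<omega>) \<longlongrightarrow> Y \<omega>) at_top)"
  have "AE \<omega> in M. ((\<lambda>t. stieltjes_integral c N L t \<omega>) \<longlongrightarrow> lim (\<lambda>T. integral_to T \<omega>)) at_top"
    using AE_regular_path AE_convergent_integral_to
  proof eventually_elim
    case (elim \<omega>)
    then have "(\<lambda>T. stieltjes_integral c N L (real T) \<omega>) \<longlonglongrightarrow> lim (\<lambda>T. integral_to T \<omega>)"
      by (simp add: convergent_LIMSEQ_iff grid_integral_tendsto(2))
    then show ?case
      unfolding stieltjes_integral_def
      by (intro stieltjes_tendsto_at_top) (use elim(1) c in \<open>auto simp: regular_path_def\<close>)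
  qed
  then have "?P (\<lambda>\<omega>. lim (\<lambda>T. integral_to T \<omega>))" by simp
  then have P: "?P (improper_integral c M N L)"
    unfolding improper_integral_def by (rule someI[where P="?P"])
  then show "improper_integral c M N L \<in> borel_measurable M" by simp
  from P have "AE \<omega> in M. ((\<lambda>t. stieltjes_integral c N L t \<omega>) \<longlongrightarrow> improper_integral c M N L \<omega>) at_top" by simp
  with AE_regular_path show "AE \<omega> in M. (\<lambda>T. integral_to T \<omega>) \<longlonglongrightarrow> improper_integral c M N L \<omega>"
  proof eventually_elim
    case (elim \<omega>)
    show ?case
      using filterlim_compose[OF elim(2) filterlim_real_sequentially]
      by (simp add: grid_integral_tendsto(2)[OF elim(1)])
  qed
qed

lemma integral_law_props:
  "prob_space (integral_law c M N L)" "sets (integral_law c M N L) = sets borel"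
  using improper_integral_props(1) by (auto simp: integral_law_def intro: prob_space_distr)

section \<open>Passage to the limit in the characteristic functions\<close>

definition char_to :: "nat \<Rightarrow> real \<Rightarrow> complex" where
  "char_to T z = (\<integral>\<omega>. iexp (z * integral_to T \<omega>) \<partial>M)"

lemma grid_char_tendsto: "(\<lambda>j. grid_char (1 / real (Suc j)) (T * Suc j) z) \<longlonglongrightarrow> char_to T z"
  unfolding grid_char_def char_to_def grid_integral_def[symmetric]
proof (rule integral_dominated_convergence[where w="\<lambda>_. 1"])
  show "AE \<omega> in M. (\<lambda>j. iexp (z * grid_integral T j \<omega>)) \<longlonglongrightarrow> iexp (z * integral_to T \<omega>)"
    using AE_regular_path by eventually_elim (intro tendsto_intros grid_integral_tendsto)
qed (auto simp del: of_real_mult)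

lemma char_to_tendsto: "(\<lambda>T. char_to T z) \<longlonglongrightarrow> char (integral_law c M N L) z"
proof -
  note [measurable] = improper_integral_props(1)
  have "(\<lambda>T. char_to T z) \<longlonglongrightarrow> (\<integral>\<omega>. iexp (z * improper_integral c M N L \<omega>) \<partial>M)"
    unfolding char_to_def
  proof (rule integral_dominated_convergence[where w="\<lambda>_. 1"])
    show "AE \<omega> in M. (\<lambda>T. iexp (z * integral_to T \<omega>)) \<longlonglongrightarrow> iexp (z * improper_integral c M N L \<omega>)"
      using improper_integral_props(2) by eventually_elim (intro tendsto_intros)
  qed (auto simp del: of_real_mult)
  also have "(\<integral>\<omega>. iexp (z * improper_integral c M N L \<omega>) \<partial>M) = char (integral_law c M N L) z"
    unfolding char_def integral_law_def by (subst integral_distr) auto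
  finally show ?thesis .
qed

text \<open>At \<open>m = T * Suc j\<close> the passage from \<open>m\<close> to
  \<open>m + 1\<close> steps is computed twice: as a step in front, expanded to first order in
  \<open>h\<close>, and as a step at the end, which is small. Comparing, dividing by
  \<open>h\<close> and refining the mesh gives the functional equation up to a defect that decays in
  \<open>T\<close>.\<close>

lemma char_to_approx_equation:
  "norm ((jump_exponent 0 z + jump_exponent pi z) / 2 * char_to T z + (jump_exponent 0 z - jump_exponent pi z) / 2 * char_to T (z / c))
    \<le> \<bar>z\<bar> * exp (- decay_rate * real T) * (v + w * d)"
proof -
  let ?h = "\<lambda>j. 1 / real (Suc j)"
  define e where "e a j = exp (?h j * jump_exponent a z)" for a j
  define \<psi> where "\<psi> j = grid_char (?h j) (T * Suc j)" for j
  \<comment> \<open>With \<open>h = 1 / Suc j\<close>, \<open>?A\<close> and \<open>?B\<close> are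
    \<open>((e0 + e1) / 2 - 1) / h\<close> and \<open>((e0 - e1) / 2) / h\<close> for the
    coefficients \<open>e0\<close>, \<open>e1\<close> of
    \<open>transition_expansion\<close>.\<close>
  let ?A = "\<lambda>j. (real (Suc j) * (e 0 j - 1) + real (Suc j) * (e pi j - 1)) / 2"
  let ?B = "\<lambda>j. (real (Suc j) * (e 0 j - 1) - real (Suc j) * (e pi j - 1)) / 2"
  have bound: "norm (?A j * \<psi> j z + ?B j * \<psi> j (z / c)) \<le> 3 * (u + w) ^ 2 * ?h j + \<bar>z\<bar> * exp (- decay_rate * real T) * (v + w * d)" for j
  proof -
    have h: "0 < ?h j" by simp
    let ?S = "\<psi> j z * ((e 0 j + e pi j) / 2) + \<psi> j (z / c) * ((e 0 j - e pi j) / 2)"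
    have "norm (grid_char (?h j) (Suc (T * Suc j)) z - ?S) \<le> 3 * (?h j * (u + w)) ^ 2"
      unfolding grid_char_Suc[OF h] e_def \<psi>_def by (intro transition_expansion[OF h] grid_char_props[OF h])
    moreover have "norm (grid_char (?h j) (Suc (T * Suc j)) z - \<psi> j z) \<le> \<bar>z\<bar> * (exp (- decay_rate * (real (T * Suc j) * ?h j)) * (?h j * (v + w * d)))"
      unfolding \<psi>_def by (rule grid_char_Suc_diff[OF h])
    moreover have "norm (?S - \<psi> j z) \<le> norm (grid_char (?h j) (Suc (T * Suc j)) z - ?S) + norm (grid_char (?h j) (Suc (T * Suc j)) z - \<psi> j z)"
      using norm_triangle_ineq4[of "grid_char (?h j) (Suc (T * Suc j)) z - \<psi> j z" "grid_char (?h j) (Suc (T * Suc j)) z - ?S"]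
      by (simp add: algebra_simps)
    moreover have "real (T * Suc j) * ?h j = real T" by (simp only: of_nat_mult) simp
    ultimately have "norm (?S - \<psi> j z) \<le> 3 * (?h j * (u + w)) ^ 2 + \<bar>z\<bar> * (exp (- decay_rate * real T) * (?h j * (v + w * d)))"
      by (simp only:)
    then have "real (Suc j) * norm (?S - \<psi> j z) \<le> real (Suc j) * (3 * (?h j * (u + w)) ^ 2 + \<bar>z\<bar> * (exp (- decay_rate * real T) * (?h j * (v + w * d))))"
      by (intro mult_left_mono) auto
    also have "\<dots> = 3 * (u + w) ^ 2 * ?h j + \<bar>z\<bar> * exp (- decay_rate * real T) * (v + w * d)"
      by (simp add: power2_eq_square field_simps del: of_nat_Suc)
    also have "real (Suc j) * norm (?S - \<psi> j z) = norm (complex_of_real (real (Suc j)) * (?S - \<psi> j z))"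
      by (simp only: norm_mult norm_of_real abs_of_nat)
    also have "complex_of_real (real (Suc j)) * (?S - \<psi> j z) = ?A j * \<psi> j z + ?B j * \<psi> j (z / c)"
      by (simp add: field_simps)
    finally show ?thesis .
  qed
  have e: "(\<lambda>j. real (Suc j) * (e a j - 1)) \<longlonglongrightarrow> jump_exponent a z" for a
    unfolding e_def using exp_difference_quotient_tendsto[of "jump_exponent a z"] by simp
  have "(\<lambda>j. norm (?A j * \<psi> j z + ?B j * \<psi> j (z / c))) \<longlonglongrightarrow>
     norm ((jump_exponent 0 z + jump_exponent pi z) / 2 * char_to T z + (jump_exponent 0 z - jump_exponent pi z) / 2 * char_to T (z / c))"
    unfolding \<psi>_def by (intro tendsto_intros e grid_char_tendsto) auto
  moreover have "(\<lambda>j. 3 * (u + w) ^ 2 * ?h j + \<bar>z\<bar> * exp (- decay_rate * real T) * (v + w * d)) \<longlonglongrightarrow>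
     3 * (u + w) ^ 2 * 0 + \<bar>z\<bar> * exp (- decay_rate * real T) * (v + w * d)"
    using LIMSEQ_inverse_real_of_nat by (intro tendsto_intros) (simp add: inverse_eq_divide)
  ultimately have "norm ((jump_exponent 0 z + jump_exponent pi z) / 2 * char_to T z + (jump_exponent 0 z - jump_exponent pi z) / 2 * char_to T (z / c))
      \<le> 3 * (u + w) ^ 2 * 0 + \<bar>z\<bar> * exp (- decay_rate * real T) * (v + w * d)"
    by (rule LIMSEQ_le) (use bound in auto)
  then show ?thesis by simp
qed

lemma functional_equation:
  "(u + v + w - v * iexp z) * char (integral_law c M N L) z = (u + w * iexp (z * d)) * char (integral_law c M N L) (z / c)"
proof -
  let ?a = "(jump_exponent 0 z + jump_exponent pi z) / 2" and ?b = "(jump_exponent 0 z - jump_exponent pi z) / 2"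
  let ?X = "char (integral_law c M N L)"
  have "(\<lambda>T. norm (?a * char_to T z + ?b * char_to T (z / c))) \<longlonglongrightarrow> norm (?a * ?X z + ?b * ?X (z / c))"
    by (intro tendsto_intros char_to_tendsto)
  moreover have "(\<lambda>T. \<bar>z\<bar> * exp (- decay_rate * real T) * (v + w * d)) \<longlonglongrightarrow> \<bar>z\<bar> * 0 * (v + w * d)"
  proof (intro tendsto_intros)
    have "(\<lambda>T. exp (- decay_rate) ^ T) \<longlonglongrightarrow> 0" using decay_rate_pos by (intro LIMSEQ_power_zero) simp
    then show "(\<lambda>T. exp (- decay_rate * real T)) \<longlonglongrightarrow> 0" by (simp add: exp_of_nat_mult[symmetric] mult.commute)
  qed
  ultimately have "norm (?a * ?X z + ?b * ?X (z / c)) \<le> \<bar>z\<bar> * 0 * (v + w * d)"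
    by (rule LIMSEQ_le) (use char_to_approx_equation in auto)
  then have "?a * ?X z + ?b * ?X (z / c) = 0" by simp
  \<comment> \<open>As \<open>iexp pi = -1\<close>, the half sum retains the exponential of the
    jumps that leave \<open>N\<close> fixed, and the half difference those of the jumps that raise
    \<open>N\<close> by 1.\<close>
  moreover have "?a = - (u + v + w - v * iexp z)" "?b = u + w * iexp (z * d)"
    by (simp_all add: jump_exponent_def exp_add field_simps)
  ultimately show ?thesis by (simp only: mult_minus_left) (simp add: algebra_simps)
qed

end

section \<open>From the functional equation to infinite divisibility\<close>

lemma driving_process_functional_equation:
  fixes c :: real
  assumes "c > 1" "p + r > 0" "driving_process c p q r k M N L"
  defines "\<mu> \<equiv> integral_law c M N L"
  shows "prob_space \<mu>" "sets \<mu> = sets borel"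
    "(1 - q * iexp z) * char \<mu> z = (p + r * iexp (z * c powi (- k))) * char \<mu> (z / c)"
proof -
  obtain u v w where uvw: "u \<ge> 0" "v \<ge> 0" "w \<ge> 0" "u + v + w > 0"
      "p = u / (u + v + w)" "q = v / (u + v + w)" "r = w / (u + v + w)"
    and P: "compound_poisson_process M (jump_measure c k u v w) (\<lambda>t \<omega>. (N t \<omega>, L t \<omega>))"
    using assms(3) unfolding driving_process_def by blast
  have "p + r = (u + w) / (u + v + w)" using uvw by (simp add: add_divide_distrib)
  then have "u + w > 0" using assms(2) uvw(4) by (simp add: zero_less_divide_iff)
  moreover have "prob_space M" using P by (simp add: compound_poisson_process_def levy_process_def)
  ultimately interpret gou_process M N L c u v w k
    using uvw P assms(1) by (simp add: gou_process_def gou_process_axioms_def)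
  show "prob_space \<mu>" "sets \<mu> = sets borel" unfolding \<mu>_def by (rule integral_law_props)+
  have s: "u = (u + v + w) * p" "v = (u + v + w) * q" "w = (u + v + w) * r" using uvw by simp_all
  \<comment> \<open>The total jump rate is a common factor of both sides, so only \<open>p\<close>,
    \<open>q\<close>, \<open>r\<close> remain after cancelling it.\<close>
  have "complex_of_real (u + v + w) * ((1 - q * iexp z) * char \<mu> z) =
        complex_of_real (u + v + w) * ((p + r * iexp (z * d)) * char \<mu> (z / c))"
  proof -
    have "complex_of_real (u + v + w) * (1 - q * iexp z) = u + v + w - v * iexp z"
      using s(2) by (simp add: right_diff_distrib flip: of_real_mult mult.assoc of_real_add)
    moreover have "complex_of_real (u + v + w) * (p + r * iexp (z * d)) = u + w * iexp (z * d)"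
      using s(1,3) by (simp add: distrib_left flip: of_real_mult mult.assoc of_real_add)
    ultimately show ?thesis
      using functional_equation[of z] unfolding \<mu>_def[symmetric] mult.assoc[symmetric] by simp
  qed
  then show "(1 - q * iexp z) * char \<mu> z = (p + r * iexp (z * c powi (- k))) * char \<mu> (z / c)"
    using uvw(4) unfolding d_def by (metis mult_left_cancel of_real_eq_0_iff less_numeral_extra(3))
qed

text \<open>Serves twice: for \<open>q < 1\<close> the denominator of the geometric characteristic
  function is nonzero, and with \<open>1 - q = p + r\<close> it dominates the coefficient on the
  right of the functional equation.\<close>

lemma geometric_denominator_ge:
  fixes q z :: real
  assumes "0 \<le> q"
  shows "1 - q \<le> norm (1 - q * iexp z)"
  using norm_triangle_ineq2[of 1 "q * iexp z"] assms by (simp add: norm_mult)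

theorem theorem4p3:
  fixes k :: int and c p q r :: real
    and M :: "'a measure" and N L :: "real \<Rightarrow> 'a \<Rightarrow> real"
    and M' :: "'b measure" and N' L' :: "real \<Rightarrow> 'b \<Rightarrow> real"
  assumes "c > 1"
    and "p \<ge> 0" and "q \<ge> 0" and "r \<ge> 0" and "p + q + r = 1"
    and "p + r > 0" and "q + r > 0"
    and "driving_process c p q r k M N L"
    and "driving_process c p q r (k + 1) M' N' L'"
    and "infinitely_divisible (integral_law c M N L)"
  shows "infinitely_divisible (integral_law c M' N' L')"
proof -
  define \<mu> where "\<mu> = integral_law c M N L"
  define \<mu>' where "\<mu>' = integral_law c M' N' L'"
  note fe = driving_process_functional_equation[OF assms(1,6,8), folded \<mu>_def]
  note fe' = driving_process_functional_equation[OF assms(1,6,9), folded \<mu>'_def]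
  interpret \<mu>: real_distribution \<mu> using fe(1,2) by (rule real_distributionI_sets)
  interpret \<mu>': real_distribution \<mu>' using fe'(1,2) by (rule real_distributionI_sets)
  have q: "0 \<le> q" "q < 1" using assms by auto
  have nz: "1 - complex_of_real q * iexp z \<noteq> 0" for z
    using geometric_denominator_ge[OF q(1), of z] q by auto
  \<comment> \<open>The candidate for \<open>char \<mu>'\<close>: the characteristic function of
    \<open>X / c\<close> plus an independent geometric variable, for \<open>X\<close> of law
    \<open>\<mu>\<close>.\<close>
  define G where "G z = of_real (1 - q) / (1 - q * iexp z) * char \<mu> (1 / c * z)" for z
  define e where "e z = char \<mu>' z - G z" for z
  have G: "(1 - q * iexp z) * G z = (p + r * iexp (z * c powi (- (k + 1)))) * G (z / c)" for z
  proof -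
    \<comment> \<open>Raising \<open>k\<close> by 1 has the same effect on the exponential as
      dividing \<open>z\<close> by \<open>c\<close>. Hence the equation for \<open>k\<close> at
      \<open>z / c\<close> applies, and its left factor cancels the geometric denominator of
      \<open>G (z / c)\<close>.\<close>
    have "z * c powi (- (k + 1)) = (z / c) * c powi (- k)"
      using assms(1) power_int_add[of c "- k" "- 1"] by (simp add: power_int_minus divide_inverse mult_ac)
    then have "(p + r * iexp (z * c powi (- (k + 1)))) * G (z / c) =
       of_real (1 - q) / (1 - q * iexp (z / c)) * ((p + r * iexp ((z / c) * c powi (- k))) * char \<mu> ((z / c) / c))"
      by (simp add: G_def)
    also have "\<dots> = of_real (1 - q) * char \<mu> (z / c)"
      unfolding fe(3)[symmetric] using nz[of "z / c"] by simp
    also have "\<dots> = (1 - q * iexp z) * G z" using nz[of z] by (simp add: G_def)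
    finally show ?thesis ..
  qed
  \<comment> \<open>The difference \<open>e\<close> solves the homogeneous equation for
    \<open>k + 1\<close>, and the coefficient on the right is bounded by
    \<open>p + r = 1 - q\<close>, hence by the one on the left. Iterating moves the argument to 0,
    where \<open>e\<close> is continuous and vanishes.\<close>
  have step: "norm (e z) \<le> norm (e (z / c))" for z
  proof -
    have "(1 - q * iexp z) * e z = (p + r * iexp (z * c powi (- (k + 1)))) * e (z / c)"
      using G[of z] fe'(3)[of z] by (simp add: e_def right_diff_distrib)
    then have "norm (1 - q * iexp z) * norm (e z) = norm (p + r * iexp (z * c powi (- (k + 1)))) * norm (e (z / c))"
      by (metis norm_mult)
    also have "\<dots> \<le> norm (1 - q * iexp z) * norm (e (z / c))"
    proof (rule mult_right_mono)
      have "norm (p + r * iexp (z * c powi (- (k + 1)))) \<le> p + r"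
        using norm_triangle_ineq[of "complex_of_real p" "r * iexp (z * c powi (- (k + 1)))"] assms(2,4)
        by (simp add: norm_mult del: of_real_mult)
      also have "\<dots> \<le> norm (1 - q * iexp z)" using geometric_denominator_ge[OF q(1), of z] assms(5) by simp
      finally show "norm (p + r * iexp (z * c powi (- (k + 1)))) \<le> norm (1 - q * iexp z)" .
    qed simp
    finally show ?thesis using nz[of z] by simp
  qed
  have "e z = 0" for z
  proof -
    have le: "norm (e z) \<le> norm (e (z / c ^ n))" for n
    proof (induction n)
      case (Suc n)
      also have "norm (e (z / c ^ n)) \<le> norm (e (z / c ^ Suc n))"
        using step[of "z / c ^ n"] by (simp add: mult.commute)
      finally show ?case .
    qed simp
    have "isCont (\<lambda>z. char \<mu> (1 / c * z)) 0"
      by (rule isCont_o2[where f="\<lambda>z. 1 / c * z", OF _ \<mu>.isCont_char]) (intro continuous_intros)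
    then have "isCont e 0"
      unfolding e_def[abs_def] G_def[abs_def]
      using nz[of 0]
      by (intro continuous_intros \<mu>'.isCont_char) auto
    moreover have "e 0 = 0" using q by (simp add: e_def G_def \<mu>.char_zero \<mu>'.char_zero)
    moreover have "(\<lambda>n. z / c ^ n) \<longlonglongrightarrow> 0"
      using LIMSEQ_divide_realpow_zero[OF assms(1)] .
    ultimately have "(\<lambda>n. e (z / c ^ n)) \<longlonglongrightarrow> 0"
      using isCont_tendsto_compose[of 0 e "\<lambda>n. z / c ^ n"] by simp
    then have "(\<lambda>n. norm (e (z / c ^ n))) \<longlonglongrightarrow> norm (0 :: complex)"
      by (rule tendsto_norm)
    then have "norm (e z) \<le> norm (0 :: complex)" by (rule LIMSEQ_le_const) (simp add: le)
    then show ?thesis by simp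
  qed
  then have "char \<mu>' z = of_real (1 - q) / (1 - of_real q * iexp z) * char \<mu> (1 / c * z)" for z
    by (simp add: e_def G_def)
  from infinitely_divisible_scale_geometric[OF assms(10)[folded \<mu>_def] fe'(1,2) q this]
  show ?thesis by (simp only: \<mu>'_def)
qed

end
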